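(* Let $\gamma\in\mathbb{R}$ be an irrational number which is not a Liouville number, let $\varepsilon>0$, and let $\psi:\mathbb{N}\to[0,1/2]$ satisfy \[ \sum_{q\in\mathbb{N}}q\psi(q)=\infty,\qquad \psi(q)=O(q^{-\varepsilon}). \] For $\boldsymbol{\alpha}=(\alpha_1,\alpha_2)\in\mathbb{T}^2$ and $Q\in\mathbb{N}$ let \[ \mathcal{N}(\boldsymbol{\alpha},Q,\gamma):=\#\Big\{(p,\mathbf{q})\in\mathbb{Z}\times(\mathbb{Z}^2\setminus\{\mathbf{0}\}):\ |\mathbf{q}|\le Q,\ |q_1\alpha_1+q_2\alpha_2-p-\gamma|\le\psi(|\mathbf{q}|)\Big\}, \] where $\mathbf{q}=(q_1,q_2)$, $|\mathbf{q}|=\max\{|q_1|,|q_2|\}$, and let $\Psi(Q):=16\sum_{q\le Q}q\psi(q)+8\sum_{q\le Q}\psi(q)$. Then for every $\delta>0$ and for almost every $\boldsymbol{\alpha}\in\mathbb{T}^2$ (with respect to Lebesgue measure), \[ \mathcal{N}(\boldsymbol{\alpha},Q,\gamma)=\Psi(Q)+O\Big(\Psi(Q)^{1/2}\big(\log\Psi(Q)\big)^{3/2+\delta}\Big),\qquad Q\to\infty. \]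
   Context: $\mathbb{T}^2=\mathbb{R}^2/\mathbb{Z}^2$, identified with $[0,1)^2$. For $x\in\mathbb{R}$, $\|x\|$ denotes the distance from $x$ to the nearest integer. A real number $\gamma$ is called a Liouville number if for every $\eta\in\mathbb{N}$ there exists an integer $q\ge 2$ with $\|q\gamma\|\le q^{-\eta}$. *)

theory Defs
  imports "HOL-Analysis.Analysis" "HOL-Library.Landau_Symbols"
begin

definition int_dist :: "real \<Rightarrow> real" where
  "int_dist x = \<bar>x - of_int (round x)\<bar>"

text \<open>With this definition, rational numbers count as Liouville numbers.\<close>

definition liouville_number :: "real \<Rightarrow> bool" where
  "liouville_number \<gamma> \<longleftrightarrow>
     (\<forall>\<eta>::nat. \<eta> \<ge> 1 \<longrightarrow> (\<exists>q::nat. q \<ge> 2 \<and> int_dist (real q * \<gamma>) \<le> 1 / real q ^ \<eta>))"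

definition sup_norm :: "int \<times> int \<Rightarrow> nat" where
  "sup_norm q = nat (max \<bar>fst q\<bar> \<bar>snd q\<bar>)"

definition approx_solutions ::
    "(nat \<Rightarrow> real) \<Rightarrow> real \<times> real \<Rightarrow> nat \<Rightarrow> real \<Rightarrow> (int \<times> (int \<times> int)) set" where
  "approx_solutions \<psi> \<alpha> Q \<gamma> =
     {(p, q). q \<noteq> (0, 0) \<and> sup_norm q \<le> Q \<and>
        \<bar>of_int (fst q) * fst \<alpha> + of_int (snd q) * snd \<alpha> - of_int p - \<gamma>\<bar> \<le> \<psi> (sup_norm q)}"

definition approx_count :: "(nat \<Rightarrow> real) \<Rightarrow> real \<times> real \<Rightarrow> nat \<Rightarrow> real \<Rightarrow> nat" where
  "approx_count \<psi> \<alpha> Q \<gamma> = card (approx_solutions \<psi> \<alpha> Q \<gamma>)"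

text \<open>The solution set is always finite, so \<^const>\<open>card\<close> is the true number of solutions.\<close>

lemma finite_approx_solutions: "finite (approx_solutions \<psi> \<alpha> Q \<gamma>)"
proof -
  define B where "B = {- int Q..int Q} \<times> {- int Q..int Q}"
  define P where "P q = {p::int. \<bar>of_int (fst q) * fst \<alpha> + of_int (snd q) * snd \<alpha> - of_int p - \<gamma>\<bar>
                              \<le> \<psi> (sup_norm q)}" for q :: "int \<times> int"
  have fin: "finite (P q)" for q
  proof -
    define c where "c = of_int (fst q) * fst \<alpha> + of_int (snd q) * snd \<alpha> - \<gamma>"
    have "P q \<subseteq> {\<lfloor>c - \<psi> (sup_norm q)\<rfloor>..\<lceil>c + \<psi> (sup_norm q)\<rceil>}"
      unfolding P_def c_def by (auto simp: floor_le_iff le_ceiling_iff abs_le_iff)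
    then show ?thesis
      by (rule finite_subset) simp
  qed
  have "approx_solutions \<psi> \<alpha> Q \<gamma> \<subseteq> prod.swap ` (SIGMA q:B. P q)"
    unfolding approx_solutions_def P_def B_def sup_norm_def
    by (auto simp: image_iff nat_le_iff abs_le_iff)
  moreover have "finite B"
    by (simp add: B_def)
  ultimately show ?thesis
    by (meson fin finite_SigmaI finite_imageI finite_subset)
qed

definition main_term :: "(nat \<Rightarrow> real) \<Rightarrow> nat \<Rightarrow> real" where
  "main_term \<psi> Q = 16 * (\<Sum>q=1..Q. real q * \<psi> q) + 8 * (\<Sum>q=1..Q. \<psi> q)"

end

theory Submission
  imports Defs "HOL-Computational_Algebra.Primes"
begin

text \<open>
  For each \<open>q\<close> the number of admissible \<open>p\<close> is a function of \<open>\<alpha>\<close> with mean \<open>2\<psi>(|q|)\<close>, and there are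
  \<open>8n\<close> vectors of norm \<open>n\<close>; the second sum in \<open>\<Psi>\<close> is \<open>O(\<Psi>\<^sup>1\<^sup>/\<^sup>2)\<close> because \<open>\<psi>\<close> is bounded.
  These functions are pairwise independent for non-parallel vectors. For parallel ones, \<open>q = av\<close> and
  \<open>q' = bv\<close> with \<open>a, b\<close> coprime and \<open>|b| \<le> a\<close>, the covariance is at most \<open>2\<psi>(|q|)/a\<close>. If the two
  strips meet at all then \<open>(a - b)\<gamma>\<close> is close to an integer, and since \<open>\<gamma>\<close> is not Liouville and \<open>\<psi>\<close>
  decays polynomially, \<open>a\<close> is at least a power of \<open>|q|\<close>. With the bound \<open>d(n) = O(n\<^sup>\<tau>)\<close> for the
  number of divisors, the variance over any block of norms is therefore at most a constant times the mean.
  A dyadic (Rademacher--Menshov) chaining argument along the values of \<open>\<Psi>\<close> and the Borel--Cantelli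
  lemma turn this into the almost sure error term.
\<close>

section \<open>The number of divisors\<close>

text \<open>The variance must be bounded by the mean without logarithmic loss, because the exponent
  3/2 + \<delta> is spent elsewhere: in the squared error one power of the logarithm comes from
  Cauchy-Schwarz over dyadic levels, one from the number of these levels, and 1 + 2\<delta> from
  summability. The obstacle is the parallel pairs. For a longer vector q and a given a there are up
  to 2a + 1 values of b, so they use up the gain 1/a in the covariance, and every possible a costs a
  constant times \<psi>(|q|). What has to stay bounded on average over |q| = n is the number of
  relevant a. Each divides both coordinates of q, which holds for at most 8n/a of the 8n vectors; as
  a is at least a power of n, taking \<tau> equal to that power makes the total O(n). The shift
  \<gamma> is what makes this possible: for \<gamma> = 0 the strips of all multiples of a vector
  meet at the origin, and there is no lower bound on a.\<close>

lemma card_divisors_mult_le: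
  fixes a b :: nat
  assumes "a > 0" "b > 0"
  shows "card {d. d dvd a * b} \<le> card {d. d dvd a} * card {d. d dvd b}"
proof -
  have fin: "finite {d. d dvd a}" "finite {d. d dvd b}"
    using assms by auto
  have "{d. d dvd a * b} \<subseteq> (\<lambda>(x, y). x * y) ` ({d. d dvd a} \<times> {d. d dvd b})"
    using division_decomp by (auto simp: image_iff) blast
  then have "card {d. d dvd a * b} \<le> card ({d. d dvd a} \<times> {d. d dvd b})"
    using fin by (meson card_image_le card_mono finite_SigmaI finite_imageI order.trans)
  then show ?thesis
    by (simp add: card_cartesian_product)
qed

lemma card_divisors_prime_power_le:
  fixes p :: nat
  assumes "prime p"
  shows "card {d. d dvd p ^ e} \<le> Suc e"
proof -
  have "{d. d dvd p ^ e} \<subseteq> (\<lambda>i. p ^ i) ` {..e}"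
    using assms by (auto simp: divides_primepow_nat)
  then have "card {d. d dvd p ^ e} \<le> card {..e}"
    by (meson card_image_le card_mono finite_atMost finite_imageI order.trans)
  then show ?thesis
    by simp
qed

text \<open>Primes p with p^\<tau> \<ge> 2 satisfy 1 + e \<le> p^(\<tau>e) and cost nothing; each of
  the finitely many smaller primes costs one fixed factor, whatever its exponent.\<close>

lemma card_divisors_le_powr:
  fixes \<tau> :: real
  assumes "\<tau> > 0"
  obtains C where "C > 0" "\<And>n::nat. n \<ge> 1 \<Longrightarrow> real (card {d. d dvd n}) \<le> C * real n powr \<tau>"
proof -
  \<comment> \<open>\<open>P\<close> solves P^\<tau> = 2. The choice of \<open>L\<close> lets
    \<open>1 + x \<le> exp x\<close> at x = \<tau> e ln 2 dominate L(1 + e); the cap 1 keeps 1/L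
    \<ge> 1, so that further small primes can only enlarge the bound.\<close>
  define P where "P = 2 powr (1 / \<tau>)"
  define L where "L = min 1 (\<tau> * ln 2)"
  have L: "0 < L" "L \<le> 1" "L \<le> \<tau> * ln 2"
    unfolding L_def using assms by auto
  define small where "small n = {p. prime p \<and> p dvd n \<and> real p < P}" for n :: nat
  define K where "K = (1 / L) ^ card {p::nat. real p < P}"
  have finP: "finite {p::nat. real p < P}"
    by (rule finite_subset[of _ "{..nat \<lceil>P\<rceil>}"]) (auto, linarith)
  have fins: "finite (small n)" for n
    unfolding small_def using finP by (rule rev_finite_subset) auto
  \<comment> \<open>The constant first depends on \<open>n\<close> through its small primes. The
    induction strips off a full prime power, so a small prime is charged once and is absent from the
    remaining factor.\<close>
  have "real (card {d. d dvd n}) \<le> (1 / L) ^ card (small n) * real n powr \<tau>" if "n \<ge> 1" for n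
    using that
  proof (induction n rule: less_induct)
    case (less n)
    show ?case
    proof (cases "n = 1")
      case True
      have "small n = {}"
        unfolding small_def True by auto
      then show ?thesis
        using True by simp
    next
      case False
      then obtain p where p: "prime p" "p dvd n"
        by (meson prime_factor_nat)
      have "p \<ge> 2"
        using p(1) by (rule prime_ge_2_nat)
      obtain e m where nm: "n = p ^ e * m" "\<not> p dvd m"
        using less.prems p(1) multiplicity_decompose'[of n p] by (metis not_one_le_zero not_prime_unit)
      have "e > 0"
        using nm p(2) by (cases e) auto
      have "m > 0"
        using nm less.prems by (cases m) auto
      have "2 \<le> p ^ e"
        using self_le_power[of p e] \<open>e > 0\<close> \<open>p \<ge> 2\<close> by simp
      then have "2 * m \<le> n"
        unfolding nm(1) by (rule mult_right_mono) simp
      then have "m < n"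
        using \<open>m > 0\<close> by simp
      define \<kappa> where "\<kappa> = (if real p < P then 1 / L else 1)"
      have large: "1 + real e \<le> \<kappa> * real p powr (\<tau> * real e)"
      proof (cases "real p < P")
        case True
        have "L * (1 + real e) \<le> 1 + \<tau> * real e * ln 2"
          using L mult_right_mono[OF L(3), of "real e"] by (simp add: algebra_simps)
        also have "\<dots> \<le> exp (\<tau> * real e * ln 2)"
          by (rule exp_ge_add_one_self)
        also have "\<dots> = 2 powr (\<tau> * real e)"
          by (simp add: powr_def)
        also have "\<dots> \<le> real p powr (\<tau> * real e)"
          using \<open>p \<ge> 2\<close> assms by (intro powr_mono2) auto
        finally show ?thesis
          using L True by (simp add: \<kappa>_def field_simps)
      next
        case False
        have "1 + real e \<le> 2 powr real e"
          using less_exp[of e] by (simp add: powr_realpow Suc_le_eq flip: of_nat_Suc)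
        also have "\<dots> = P powr (\<tau> * real e)"
          unfolding P_def using assms by (simp add: powr_powr)
        also have "\<dots> \<le> real p powr (\<tau> * real e)"
          using False assms by (intro powr_mono2) (auto simp: P_def)
        finally show ?thesis
          using False by (simp add: \<kappa>_def)
      qed
      have small_card: "\<kappa> * (1 / L) ^ card (small m) \<le> (1 / L) ^ card (small n)"
      proof (cases "real p < P")
        case True
        have "insert p (small m) \<subseteq> small n"
          using True p nm unfolding small_def by auto
        moreover have "p \<notin> small m"
          using nm unfolding small_def by auto
        ultimately have "Suc (card (small m)) \<le> card (small n)"
          using fins by (metis card_insert_disjoint card_mono)
        then show ?thesis
          using power_increasing[of "Suc (card (small m))" "card (small n)" "1 / L"] L True
          by (simp add: \<kappa>_def)
      next
        case False
        have "small m \<subseteq> small n"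
          using nm unfolding small_def by auto
        then show ?thesis
          using power_increasing[OF card_mono[OF fins], of "small m" n "1 / L"] L False
          by (simp add: \<kappa>_def)
      qed
      have "card {d. d dvd n} \<le> Suc e * card {d. d dvd m}"
        using card_divisors_mult_le[of "p ^ e" m] card_divisors_prime_power_le[OF p(1), of e]
          \<open>m > 0\<close> \<open>p \<ge> 2\<close> nm(1)
        by (metis le_trans mult_le_mono1 not_numeral_le_zero zero_less_power gr0I)
      then have "real (card {d. d dvd n}) \<le> (1 + real e) * real (card {d. d dvd m})"
        by (metis of_nat_Suc of_nat_le_iff of_nat_mult)
      also have "\<dots> \<le> (\<kappa> * real p powr (\<tau> * real e)) * ((1 / L) ^ card (small m) * real m powr \<tau>)"
        using less.IH[OF \<open>m < n\<close>] \<open>m > 0\<close> large L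
        by (intro mult_mono) (auto simp: \<kappa>_def)
      also have "\<dots> = (\<kappa> * (1 / L) ^ card (small m)) * (real p powr (\<tau> * real e) * real m powr \<tau>)"
        by (simp only: mult_ac)
      also have "real p powr (\<tau> * real e) * real m powr \<tau> = real n powr \<tau>"
      proof -
        have "real p powr (\<tau> * real e) = (real p ^ e) powr \<tau>"
          using \<open>p \<ge> 2\<close> by (simp add: powr_powr mult.commute flip: powr_realpow)
        then show ?thesis
          using nm(1) by (simp add: powr_mult)
      qed
      also have "\<kappa> * (1 / L) ^ card (small m) * real n powr \<tau> \<le> (1 / L) ^ card (small n) * real n powr \<tau>"
        using small_card by (intro mult_right_mono) auto
      finally show ?thesis .
    qed
  qed
  moreover have "(1 / L) ^ card (small n) \<le> K" for n
    unfolding K_def using L finP by (intro power_increasing card_mono) (auto simp: small_def)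
  ultimately have "real (card {d. d dvd n}) \<le> K * real n powr \<tau>" if "n \<ge> 1" for n
    using that by (meson mult_right_mono order.trans powr_ge_zero)
  moreover have "K > 0"
    unfolding K_def using L by simp
  ultimately show ?thesis
    using that by blast
qed

section \<open>From variance bounds to almost sure asymptotics\<close>

text \<open>Clearing the binary digits of \<open>j\<close> one at a time, from the lowest upwards,
  leads from \<open>j\<close> to 0 along at most one dyadic interval per level. Cauchy-Schwarz over
  these steps gives \<open>Suc r\<close>, and replacing each squared step by the sum over its whole
  level makes the bound independent of \<open>j\<close>. There are r + 1 levels because
  \<open>j = 2 ^ r\<close> is allowed.\<close>

lemma dyadic_chaining:
  fixes h :: "nat \<Rightarrow> real"
  assumes "j \<le> 2 ^ r"
  shows "(h j - h 0)\<^sup>2 \<le> real (Suc r) *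
    (\<Sum>s\<le>r. \<Sum>u<2 ^ (r - s). (h (Suc u * 2 ^ s) - h (u * 2 ^ s))\<^sup>2)"
proof -
  define T where "T s = (\<Sum>u<2 ^ (r - s). (h (Suc u * 2 ^ s) - h (u * 2 ^ s))\<^sup>2)" for s
  define t where "t k = (j div 2 ^ k) * 2 ^ k" for k
  have T0: "T s \<ge> 0" for s
    unfolding T_def by (intro sum_nonneg) auto
  have step: "(h (t k) - h (t (Suc k)))\<^sup>2 \<le> T k" if "k \<le> r" for k
  proof -
    define w where "w = j div 2 ^ k"
    have w_le: "w \<le> 2 ^ (r - k)"
    proof -
      have "w \<le> 2 ^ r div 2 ^ k"
        unfolding w_def using assms by (rule div_le_mono)
      then show ?thesis
        using that by (simp add: power_diff)
    qed
    have t2: "t (Suc k) = (w div 2) * 2 * 2 ^ k"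
      unfolding t_def w_def by (simp add: div_mult2_eq[symmetric] mult.commute mult.left_commute)
    show ?thesis
    proof (cases "even w")
      case True
      then have "t (Suc k) = t k"
        using t2 unfolding t_def w_def by simp
      then show ?thesis
        using T0 by simp
    next
      case False
      then obtain v where v: "w = Suc (2 * v)"
        by (elim oddE) auto
      \<comment> \<open>An odd \<open>w\<close> crosses exactly the interval with index 2v = w - 1,
        which lies in the range of the level sum because \<open>w \<le> 2 ^ (r - k)\<close>.\<close>
      have "2 * v < 2 ^ (r - k)"
        using w_le v by simp
      moreover have "t (Suc k) = (2 * v) * 2 ^ k"
        using t2 v by simp
      moreover have "t k = Suc (2 * v) * 2 ^ k"
        using v unfolding t_def w_def by simp
      ultimately show ?thesis
        unfolding T_def
        by (metis (no_types, lifting) finite_lessThan lessThan_iff member_le_sum zero_le_power2)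
    qed
  qed
  have "h j - h 0 = (\<Sum>k<Suc r. h (t k) - h (t (Suc k)))"
  proof -
    have "j < 2 ^ Suc r"
      using assms by (simp add: le_less_trans)
    then have "t (Suc r) = 0" "t 0 = j"
      unfolding t_def by simp_all
    then show ?thesis
      using sum_lessThan_telescope'[of "\<lambda>k. h (t k)" "Suc r"] by simp
  qed
  then have "(h j - h 0)\<^sup>2 = (\<Sum>k<Suc r. 1 * (h (t k) - h (t (Suc k))))\<^sup>2"
    by simp
  also have "\<dots> \<le> (\<Sum>k<Suc r. 1\<^sup>2) * (\<Sum>k<Suc r. (h (t k) - h (t (Suc k)))\<^sup>2)"
    by (rule Cauchy_Schwarz_ineq_sum)
  also have "\<dots> \<le> real (Suc r) * (\<Sum>k<Suc r. T k)"
    by (intro mult_mono sum_mono sum_nonneg step) auto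
  finally show ?thesis
    unfolding T_def lessThan_Suc_atMost .
qed

text \<open>Borel-Cantelli in integrated form: the sum of all \<open>G r\<close> has finite
  integral, hence is finite almost everywhere, and it dominates each term. One constant per point
  then serves every \<open>r\<close>, with no exceptional levels.\<close>

lemma AE_bounded_of_summable_nn_integral:
  fixes G :: "nat \<Rightarrow> 'a \<Rightarrow> real"
  assumes meas [measurable]: "\<And>r. G r \<in> borel_measurable M"
    and nonneg: "\<And>r x. G r x \<ge> 0"
    and le: "\<And>r. (\<integral>\<^sup>+x. ennreal (G r x) \<partial>M) \<le> ennreal (b r)"
    and b0: "\<And>r. b r \<ge> 0" and summ: "summable b"
  shows "AE x in M. \<exists>C. \<forall>r. G r x \<le> C"
proof -
  have "(\<integral>\<^sup>+x. (\<Sum>r. ennreal (G r x)) \<partial>M) = (\<Sum>r. \<integral>\<^sup>+x. ennreal (G r x) \<partial>M)"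
    by (rule nn_integral_suminf) simp
  also have "\<dots> \<le> (\<Sum>r. ennreal (b r))"
    by (intro suminf_le le) auto
  also have "\<dots> = ennreal (\<Sum>r. b r)"
    by (rule suminf_ennreal2[OF b0 summ])
  finally have "(\<integral>\<^sup>+x. (\<Sum>r. ennreal (G r x)) \<partial>M) \<noteq> \<infinity>"
    using neq_top_trans[OF ennreal_neq_top] by (simp add: infinity_ennreal_def)
  then have "AE x in M. (\<Sum>r. ennreal (G r x)) \<noteq> \<infinity>"
    by (rule nn_integral_noteq_infinite[rotated]) simp
  then show ?thesis
  proof eventually_elim
    case (elim x)
    have "G r x \<le> enn2real (\<Sum>r. ennreal (G r x))" for r
    proof -
      have "ennreal (G r x) \<le> (\<Sum>r. ennreal (G r x))"
        using sum_le_suminf[of "\<lambda>r. ennreal (G r x)" "{r}"] by simp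
      then show ?thesis
        using elim nonneg[of r x]
        by (metis enn2real_ennreal enn2real_mono infinity_ennreal_def less_top)
    qed
    then show ?case
      by blast
  qed
qed

text \<open>Within one level the increments of \<Phi> telescope, so every level costs the same
  total, and the number of levels gives the factor \<open>Suc r\<close>. This is where linearity of
  the variance bound in the increment of \<Phi> pays off.\<close>

lemma nn_integral_dyadic_squares_le:
  fixes D :: "nat \<Rightarrow> 'a \<Rightarrow> real" and \<Phi> :: "nat \<Rightarrow> real"
  assumes meas [measurable]: "\<And>n. D n \<in> borel_measurable M"
    and K: "K \<ge> 0"
    and var: "\<And>m n. m \<le> n \<Longrightarrow> (\<integral>\<^sup>+x. ennreal ((D n x - D m x)\<^sup>2) \<partial>M) \<le> ennreal (K * (\<Phi> n - \<Phi> m))"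
    and mono: "mono \<Phi>" "mono t"
  shows "(\<integral>\<^sup>+x. ennreal (\<Sum>s\<le>r. \<Sum>u<2 ^ (r - s). (D (t (Suc u * 2 ^ s)) x - D (t (u * 2 ^ s)) x)\<^sup>2) \<partial>M)
     \<le> ennreal (real (Suc r) * (K * (\<Phi> (t (2 ^ r)) - \<Phi> (t 0))))"
proof -
  have tm: "t (u * 2 ^ s) \<le> t (Suc u * 2 ^ s)" for u s
    by (intro monoD[OF mono(2)]) simp
  have \<Phi>m: "\<Phi> (t (u * 2 ^ s)) \<le> \<Phi> (t (Suc u * 2 ^ s))" for u s
    by (intro monoD[OF mono(1)] tm)
  have "(\<integral>\<^sup>+x. ennreal (\<Sum>s\<le>r. \<Sum>u<2 ^ (r - s). (D (t (Suc u * 2 ^ s)) x - D (t (u * 2 ^ s)) x)\<^sup>2) \<partial>M)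
    = (\<Sum>s\<le>r. \<Sum>u<2 ^ (r - s). \<integral>\<^sup>+x. ennreal ((D (t (Suc u * 2 ^ s)) x - D (t (u * 2 ^ s)) x)\<^sup>2) \<partial>M)"
  proof -
    have "ennreal (\<Sum>s\<le>r. \<Sum>u<2 ^ (r - s). (D (t (Suc u * 2 ^ s)) x - D (t (u * 2 ^ s)) x)\<^sup>2)
      = (\<Sum>s\<le>r. \<Sum>u<2 ^ (r - s). ennreal ((D (t (Suc u * 2 ^ s)) x - D (t (u * 2 ^ s)) x)\<^sup>2))" for x
      by (simp add: sum_nonneg)
    then show ?thesis
      by (simp add: nn_integral_sum del: sum_ennreal)
  qed
  also have "\<dots> \<le> (\<Sum>s\<le>r. \<Sum>u<2 ^ (r - s). ennreal (K * (\<Phi> (t (Suc u * 2 ^ s)) - \<Phi> (t (u * 2 ^ s)))))"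
    by (intro sum_mono var tm)
  also have "\<dots> = ennreal (\<Sum>s\<le>r. \<Sum>u<2 ^ (r - s). K * (\<Phi> (t (Suc u * 2 ^ s)) - \<Phi> (t (u * 2 ^ s))))"
    using K \<Phi>m by (simp add: sum_ennreal sum_nonneg)
  also have "(\<Sum>s\<le>r. \<Sum>u<2 ^ (r - s). K * (\<Phi> (t (Suc u * 2 ^ s)) - \<Phi> (t (u * 2 ^ s))))
     = (\<Sum>s\<le>r. K * (\<Phi> (t (2 ^ r)) - \<Phi> (t 0)))"
  proof (intro sum.cong refl)
    fix s assume s: "s \<in> {..r}"
    have "(\<Sum>u<2 ^ (r - s). \<Phi> (t (Suc u * 2 ^ s)) - \<Phi> (t (u * 2 ^ s)))
        = \<Phi> (t (2 ^ (r - s) * 2 ^ s)) - \<Phi> (t 0)"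
      using sum_lessThan_telescope[of "\<lambda>u. \<Phi> (t (u * 2 ^ s))" "2 ^ (r - s)"] by simp
    also have "(2::nat) ^ (r - s) * 2 ^ s = 2 ^ r"
      using s by (simp add: power_add[symmetric])
    finally show "(\<Sum>u<2 ^ (r - s). K * (\<Phi> (t (Suc u * 2 ^ s)) - \<Phi> (t (u * 2 ^ s))))
        = K * (\<Phi> (t (2 ^ r)) - \<Phi> (t 0))"
      by (simp add: sum_distrib_left[symmetric])
  qed
  finally show ?thesis
    by simp
qed

text \<open>Chaining runs over the integer values of \<Phi> instead of over the indices, so that
  about 2^r sampling points control all Q with \<Phi>(Q) < 2^r. Monotonicity of \<open>F\<close>
  interpolates between sampling points at the price of the summand 1.\<close>

lemma quantitative_Borel_Cantelli:
  fixes F :: "nat \<Rightarrow> 'a \<Rightarrow> real" and \<Phi> :: "nat \<Rightarrow> real"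
  assumes meas [measurable]: "\<And>n. F n \<in> borel_measurable M"
    and Fmono: "\<And>x. mono (\<lambda>n. F n x)" and F0: "\<And>x. F 0 x = 0"
    and \<Phi>0: "\<Phi> 0 = 0" and \<Phi>mono: "mono \<Phi>" and \<Phi>lim: "filterlim \<Phi> at_top sequentially"
    and K: "K \<ge> 0"
    and var: "\<And>m n. m \<le> n \<Longrightarrow>
      (\<integral>\<^sup>+x. ennreal ((F n x - F m x - (\<Phi> n - \<Phi> m))\<^sup>2) \<partial>M) \<le> ennreal (K * (\<Phi> n - \<Phi> m))"
    and \<delta>: "\<delta> > 0"
  shows "AE x in M. \<exists>C\<ge>0. \<forall>r Q. \<Phi> Q < 2 ^ r \<longrightarrow>
    \<bar>F Q x - \<Phi> Q\<bar> \<le> C * (2 powr (real r / 2) * real (Suc r) powr (3/2 + \<delta>)) + 1"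
proof -
  define D where "D n x = F n x - \<Phi> n" for n x
  have [measurable]: "D n \<in> borel_measurable M" for n
    unfolding D_def by measurable
  have varD: "(\<integral>\<^sup>+x. ennreal ((D n x - D m x)\<^sup>2) \<partial>M) \<le> ennreal (K * (\<Phi> n - \<Phi> m))"
    if "m \<le> n" for m n
    using var[OF that] unfolding D_def by (simp add: algebra_simps)
  have ex_ge: "\<exists>n. \<Phi> n > B" for B
  proof -
    have "eventually (\<lambda>n. \<Phi> n > B) sequentially"
      using \<Phi>lim by (simp add: filterlim_at_top_dense)
    then show ?thesis
      by (meson eventually_happens sequentially_bot)
  qed
  have fin: "finite {n. \<Phi> n \<le> B}" for B
  proof -
    obtain n where "\<Phi> n > B"
      using ex_ge by blast
    then have "{n. \<Phi> n \<le> B} \<subseteq> {..n}"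
      using \<Phi>mono by (smt (verit, best) atMost_iff linear mem_Collect_eq monoD subsetI)
    then show ?thesis
      by (rule finite_subset) simp
  qed
  \<comment> \<open>Jumps of \<Phi> may skip many integers, so \<Phi> need not come near j at either
    index. Only \<Phi>(up j) \<le> j \<le> \<Phi>(lo j) is used: \<open>up\<close> bounds the count
    from above and \<open>lo\<close> from below.\<close>
  define up where "up j = Max {n. \<Phi> n \<le> real j}" for j :: nat
  define lo where "lo j = (LEAST n. \<Phi> n \<ge> real j)" for j :: nat
  have up: "\<Phi> (up j) \<le> real j" and up_ge: "\<Phi> n \<le> real j \<Longrightarrow> n \<le> up j" for j n
  proof -
    have "0 \<in> {n. \<Phi> n \<le> real j}"
      using \<Phi>0 by simp
    then have "up j \<in> {n. \<Phi> n \<le> real j}"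
      unfolding up_def using fin by (metis Max_in empty_iff)
    then show "\<Phi> (up j) \<le> real j"
      by simp
    show "\<Phi> n \<le> real j \<Longrightarrow> n \<le> up j"
      unfolding up_def using fin by simp
  qed
  have lo: "\<Phi> (lo j) \<ge> real j" and lo_le: "\<Phi> n \<ge> real j \<Longrightarrow> lo j \<le> n" for j n
  proof -
    show "\<Phi> (lo j) \<ge> real j"
      unfolding lo_def using ex_ge[of "real j"] by (metis (mono_tags, lifting) LeastI less_imp_le)
    show "\<Phi> n \<ge> real j \<Longrightarrow> lo j \<le> n"
      unfolding lo_def by (rule Least_le)
  qed
  \<comment> \<open>Both sequences must start at 0, where the deviation vanishes;
    \<open>up 0\<close> is positive when \<Phi> is 0 on an initial stretch. The cut-off at
    \<open>up (2 ^ r)\<close> keeps \<Phi> at most 2^r at the last sampling point, which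
    \<open>lo (2 ^ r)\<close> may overshoot.\<close>
  define t1 where "t1 j = (if j = 0 then 0 else up j)" for j
  define t2 where "t2 r j = min (lo j) (up (2 ^ r))" for r j
  have "mono t1"
    by (intro monoI) (auto simp: t1_def intro!: up_ge order.trans[OF up])
  have mono2: "mono (t2 r)" for r
    by (intro monoI) (auto simp: t2_def min_le_iff_disj intro!: lo_le order.trans[OF _ lo])
  have t20: "t2 r 0 = 0" for r
    using lo_le[of 0 0] \<Phi>0 by (simp add: t2_def)
  define S where "S t r x =
    (\<Sum>s\<le>r. \<Sum>u<2 ^ (r - s). (D (t (Suc u * 2 ^ s)) x - D (t (u * 2 ^ s)) x)\<^sup>2)" for t r x
  have S0: "S t r x \<ge> 0" for t r x
    unfolding S_def by (intro sum_nonneg) auto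
  have [measurable]: "S t r \<in> borel_measurable M" for t r
    unfolding S_def by measurable
  \<comment> \<open>The integral of \<open>S\<close> is at most a constant times 2^r (r + 1). The
    weight carries a further (r + 1)^(1 + 2\<delta>), which leaves a summable series.\<close>
  define w where "w r = 2 ^ r * real (Suc r) powr (2 + 2 * \<delta>)" for r :: nat
  have w0: "w r > 0" for r
    unfolding w_def by simp
  define G where "G r x = (S t1 r x + S (t2 r) r x) / w r" for r x
  have [measurable]: "G r \<in> borel_measurable M" for r
    unfolding G_def by measurable
  have G_int: "(\<integral>\<^sup>+x. ennreal (G r x) \<partial>M) \<le> ennreal (2 * K * real (Suc r) powr (- 1 - 2 * \<delta>))" for r
  proof -
    have S_int: "(\<integral>\<^sup>+x. ennreal (S t r x) \<partial>M) \<le> ennreal (real (Suc r) * (K * 2 ^ r))"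
      if "mono t" "t 0 = 0" "\<Phi> (t (2 ^ r)) \<le> 2 ^ r" for t
    proof -
      have "(\<integral>\<^sup>+x. ennreal (S t r x) \<partial>M)
          \<le> ennreal (real (Suc r) * (K * (\<Phi> (t (2 ^ r)) - \<Phi> (t 0))))"
        unfolding S_def by (intro nn_integral_dyadic_squares_le varD K \<Phi>mono that) auto
      also have "\<dots> \<le> ennreal (real (Suc r) * (K * 2 ^ r))"
        using that \<Phi>0 K by (intro ennreal_leI mult_left_mono) auto
      finally show ?thesis .
    qed
    have "(\<integral>\<^sup>+x. ennreal (S t1 r x) \<partial>M) \<le> ennreal (real (Suc r) * (K * 2 ^ r))"
      using up[of "2 ^ r"] by (intro S_int \<open>mono t1\<close>) (auto simp: t1_def)
    moreover have "(\<integral>\<^sup>+x. ennreal (S (t2 r) r x) \<partial>M) \<le> ennreal (real (Suc r) * (K * 2 ^ r))"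
    proof (intro S_int mono2 t20)
      have "\<Phi> (t2 r (2 ^ r)) \<le> \<Phi> (up (2 ^ r))"
        by (intro monoD[OF \<Phi>mono]) (simp add: t2_def)
      then show "\<Phi> (t2 r (2 ^ r)) \<le> 2 ^ r"
        using up[of "2 ^ r"] by simp
    qed
    moreover have "(\<integral>\<^sup>+x. ennreal (G r x) \<partial>M)
       = ennreal (1 / w r) * ((\<integral>\<^sup>+x. ennreal (S t1 r x) \<partial>M) + (\<integral>\<^sup>+x. ennreal (S (t2 r) r x) \<partial>M))"
    proof -
      have "(\<integral>\<^sup>+x. ennreal (G r x) \<partial>M)
        = (\<integral>\<^sup>+x. ennreal (1 / w r) * (ennreal (S t1 r x) + ennreal (S (t2 r) r x)) \<partial>M)"
        unfolding G_def using w0[of r] S0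
        by (simp add: ennreal_mult[symmetric] ennreal_plus[symmetric] del: ennreal_plus)
      also have "\<dots> = ennreal (1 / w r) * (\<integral>\<^sup>+x. ennreal (S t1 r x) + ennreal (S (t2 r) r x) \<partial>M)"
        by (rule nn_integral_cmult) simp
      finally show ?thesis
        by (simp add: nn_integral_add)
    qed
    ultimately have "(\<integral>\<^sup>+x. ennreal (G r x) \<partial>M)
       \<le> ennreal (1 / w r) * (ennreal (real (Suc r) * (K * 2 ^ r)) + ennreal (real (Suc r) * (K * 2 ^ r)))"
      by (simp add: add_mono mult_left_mono)
    also have "\<dots> = ennreal (1 / w r * (2 * (real (Suc r) * (K * 2 ^ r))))"
      using K w0[of r]
      by (simp add: ennreal_mult[symmetric] ennreal_plus[symmetric] del: ennreal_plus)
    also have "1 / w r * (2 * (real (Suc r) * (K * 2 ^ r))) = 2 * K * (real (Suc r) powr 1 / real (Suc r) powr (2 + 2 * \<delta>))"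
      unfolding w_def by (simp add: field_simps)
    also have "real (Suc r) powr 1 / real (Suc r) powr (2 + 2 * \<delta>) = real (Suc r) powr (- 1 - 2 * \<delta>)"
      by (subst powr_diff[symmetric]) (simp add: algebra_simps)
    finally show ?thesis .
  qed
  have "summable (\<lambda>r. 2 * K * real (Suc r) powr (- 1 - 2 * \<delta>))"
  proof -
    have "summable (\<lambda>r. real r powr (- 1 - 2 * \<delta>))"
      using \<delta> by (subst summable_real_powr_iff) auto
    then have "summable (\<lambda>r. real (Suc r) powr (- 1 - 2 * \<delta>))"
      by (subst summable_Suc_iff)
    then show ?thesis
      by (rule summable_mult)
  qed
  then have "AE x in M. \<exists>C. \<forall>r. G r x \<le> C"
    using G_int K S0 w0
    by (intro AE_bounded_of_summable_nn_integral[of G M "\<lambda>r. 2 * K * real (Suc r) powr (- 1 - 2 * \<delta>)"])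
       (auto simp: G_def less_imp_le)
  then show ?thesis
  proof eventually_elim
    case (elim x)
    then obtain C where C: "G r x \<le> C" for r
      by blast
    define E where "E r = sqrt C * (2 powr (real r / 2) * real (Suc r) powr (3/2 + \<delta>))" for r
    have C0: "C \<ge> 0"
      using C[of 0] S0 w0[of 0] by (smt (verit) G_def divide_nonneg_pos)
    have DE: "\<bar>D (t j) x\<bar> \<le> E r"
      if "j \<le> 2 ^ r" "t = t1 \<or> t = t2 r" for t j r
    proof -
      have "D 0 x = 0"
        unfolding D_def using F0 \<Phi>0 by simp
      moreover have "t 0 = 0"
        using that t20 by (auto simp: t1_def)
      ultimately have "(D (t j) x)\<^sup>2 \<le> real (Suc r) * S t r x"
        using dyadic_chaining[OF that(1), of "\<lambda>j. D (t j) x"] unfolding S_def by simp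
      also have "S t r x \<le> S t1 r x + S (t2 r) r x"
        using that(2) S0[of t1 r x] S0[of "t2 r" r x] by auto
      also have "\<dots> = G r x * w r"
        unfolding G_def using w0[of r] by simp
      also have "\<dots> \<le> C * w r"
        using C w0[of r] by (intro mult_right_mono) auto
      also have "real (Suc r) * (C * w r) = (E r)\<^sup>2"
      proof -
        have "(2 powr (real r / 2))\<^sup>2 = (2::real) ^ r"
          by (simp add: powr_power powr_realpow)
        moreover have "(real (Suc r) powr (3/2 + \<delta>))\<^sup>2 = real (Suc r) * real (Suc r) powr (2 + 2 * \<delta>)"
        proof -
          have "(real (Suc r) powr (3/2 + \<delta>))\<^sup>2 = real (Suc r) powr (1 + (2 + 2 * \<delta>))"
            by (simp add: power2_eq_square powr_add[symmetric])
          then show ?thesis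
            by (subst (asm) powr_add) simp
        qed
        ultimately show ?thesis
          unfolding E_def w_def using C0 by (simp add: power_mult_distrib)
      qed
      finally have "(D (t j) x)\<^sup>2 \<le> (E r)\<^sup>2"
        by (simp add: mult_left_mono)
      moreover have "E r \<ge> 0"
        unfolding E_def using C0 by simp
      ultimately show ?thesis
        by (metis abs_le_square_iff abs_of_nonneg)
    qed
    have "\<bar>F Q x - \<Phi> Q\<bar> \<le> E r + 1" if Q: "\<Phi> Q < 2 ^ r" for r Q
    proof -
      have \<Phi>Q0: "\<Phi> Q \<ge> 0"
        using \<Phi>0 \<Phi>mono by (metis le0 monoD)
      \<comment> \<open>Since \<Phi>(Q) < 2^r is strict, also \<open>Suc j \<le> 2 ^ r\<close>, so
        both \<open>j\<close> and \<open>Suc j\<close> are within reach of the chaining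
        bound.\<close>
      define j where "j = nat \<lfloor>\<Phi> Q\<rfloor>"
      have j: "real j \<le> \<Phi> Q" "\<Phi> Q < real j + 1"
        unfolding j_def using \<Phi>Q0 by linarith+
      have j_less: "real j < 2 ^ r"
        using j(1) Q by linarith
      then have j_less: "j < 2 ^ r"
        by (metis of_nat_less_iff of_nat_numeral of_nat_power)
      have "F Q x \<le> F (up (Suc j)) x"
        using up_ge[of Q "Suc j"] j Fmono[of x] by (auto intro: monoD)
      moreover have "\<bar>D (up (Suc j)) x\<bar> \<le> E r"
        using DE[of "Suc j" r t1] j_less by (simp add: t1_def)
      moreover have "\<Phi> (up (Suc j)) \<le> \<Phi> Q + 1"
        using up[of "Suc j"] j by simp
      moreover have lo_j: "lo j \<le> Q"
        using lo_le j by simp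
      then have "F (lo j) x \<le> F Q x"
        using Fmono[of x] by (auto intro: monoD)
      moreover have "\<bar>D (lo j) x\<bar> \<le> E r"
      proof -
        have "Q \<le> up (2 ^ r)"
          using up_ge[of Q "2 ^ r"] Q by simp
        then have "t2 r j = lo j"
          using lo_j by (simp add: t2_def)
        then show ?thesis
          using DE[of j r "t2 r"] j_less by simp
      qed
      moreover have "\<Phi> (lo j) \<ge> \<Phi> Q - 1"
        using lo[of j] j by simp
      ultimately show ?thesis
        unfolding D_def by linarith
    qed
    then show ?case
      using C0 unfolding E_def by (intro exI[of _ "sqrt C"]) auto
  qed
qed

section \<open>Periodic functions on the circle and the torus\<close>

lemma periodic_int:
  fixes f :: "real \<Rightarrow> 'a"
  assumes "\<And>x. f (x + 1) = f x"
  shows "f (x + of_int m) = f x"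
proof (induction m rule: int_induct[where k = 0])
  case (step1 i)
  then show ?case
    using assms[of "x + of_int i"] by (simp add: add.assoc)
next
  case (step2 i)
  then show ?case
    using assms[of "x + of_int i - 1"] by (simp add: algebra_simps)
qed simp

lemma nn_integral_lborel_shift:
  fixes f :: "real \<Rightarrow> ennreal"
  assumes "f \<in> borel_measurable borel"
  shows "(\<integral>\<^sup>+x. f (x + c) \<partial>lborel) = (\<integral>\<^sup>+x. f x \<partial>lborel)"
  using nn_integral_real_affine[OF assms, of 1 c] by (simp add: add.commute)

text \<open>Values in \<open>ennreal\<close> make Fubini and additivity available from measurability
  alone, and the integer translates of the half-open domain tile the line without overlap.\<close>

definition circle_integral :: "(real \<Rightarrow> ennreal) \<Rightarrow> ennreal" where
  "circle_integral f = (\<integral>\<^sup>+x. f x * indicator {0..<1} x \<partial>lborel)"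

lemma circle_integral_int_interval:
  fixes f :: "real \<Rightarrow> ennreal"
  assumes [measurable]: "f \<in> borel_measurable borel" and per: "\<And>x. f (x + 1) = f x"
  shows "(\<integral>\<^sup>+x. f x * indicator {of_int m..<of_int m + 1} x \<partial>lborel) = circle_integral f"
proof -
  have "(\<integral>\<^sup>+x. f x * indicator {of_int m..<of_int m + 1} x \<partial>lborel)
     = (\<integral>\<^sup>+x. f (x + of_int m) * indicator {of_int m..<of_int m + 1} (x + of_int m) \<partial>lborel)"
    by (rule nn_integral_lborel_shift[symmetric]) simp
  also have "\<dots> = circle_integral f"
    unfolding circle_integral_def periodic_int[of f, OF per]
    by (intro nn_integral_cong) (simp add: indicator_def)
  finally show ?thesis .
qed

lemma circle_integral_shift:
  fixes f :: "real \<Rightarrow> ennreal"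
  assumes [measurable]: "f \<in> borel_measurable borel" and per: "\<And>x. f (x + 1) = f x"
  shows "circle_integral (\<lambda>x. f (x + c)) = circle_integral f"
proof -
  define t where "t = frac c"
  have t: "0 \<le> t" "t < 1"
    unfolding t_def by (auto simp: frac_lt_1)
  have "f (x + c) = f (x + t)" for x
    using periodic_int[of f "x + t" "\<lfloor>c\<rfloor>", OF per] unfolding t_def frac_def by (simp add: algebra_simps)
  then have "circle_integral (\<lambda>x. f (x + c)) = (\<integral>\<^sup>+x. f (x + t) * indicator {t..<1 + t} (x + t) \<partial>lborel)"
    unfolding circle_integral_def by (intro nn_integral_cong) (simp add: indicator_def)
  also have "\<dots> = (\<integral>\<^sup>+x. f x * indicator {t..<1 + t} x \<partial>lborel)"
    by (rule nn_integral_lborel_shift) simp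
  also have "\<dots> = (\<integral>\<^sup>+x. f x * indicator {t..<1} x + f x * indicator {1..<1 + t} x \<partial>lborel)"
    using t by (intro nn_integral_cong) (auto simp: indicator_def)
  also have "\<dots> = (\<integral>\<^sup>+x. f x * indicator {t..<1} x \<partial>lborel) + (\<integral>\<^sup>+x. f x * indicator {1..<1 + t} x \<partial>lborel)"
    by (rule nn_integral_add) auto
  also have "(\<integral>\<^sup>+x. f x * indicator {1..<1 + t} x \<partial>lborel)
      = (\<integral>\<^sup>+x. f (x + 1) * indicator {1..<1 + t} (x + 1) \<partial>lborel)"
    by (rule nn_integral_lborel_shift[symmetric]) simp
  also have "\<dots> = (\<integral>\<^sup>+x. f x * indicator {0..<t} x \<partial>lborel)"
    unfolding per by (intro nn_integral_cong) (simp add: indicator_def)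
  also have "(\<integral>\<^sup>+x. f x * indicator {t..<1} x \<partial>lborel) + (\<integral>\<^sup>+x. f x * indicator {0..<t} x \<partial>lborel)
      = (\<integral>\<^sup>+x. f x * indicator {t..<1} x + f x * indicator {0..<t} x \<partial>lborel)"
    by (rule nn_integral_add[symmetric]) auto
  also have "\<dots> = circle_integral f"
    unfolding circle_integral_def using t by (intro nn_integral_cong) (auto simp: indicator_def)
  finally show ?thesis .
qed

lemma circle_integral_uminus:
  fixes f :: "real \<Rightarrow> ennreal"
  assumes [measurable]: "f \<in> borel_measurable borel" and per: "\<And>x. f (x + 1) = f x"
  shows "circle_integral (\<lambda>x. f (- x)) = circle_integral f"
proof -
  have "circle_integral f = (\<integral>\<^sup>+x. f (1 + -1 * x) * indicator {0..<1} (1 + -1 * x) \<partial>lborel)"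
    unfolding circle_integral_def using nn_integral_real_affine[of "\<lambda>x. f x * indicator {0..<1} x" "-1" 1] by simp
  also have "\<dots> = circle_integral (\<lambda>x. f (- x))"
    unfolding circle_integral_def
  proof (rule nn_integral_cong_AE)
    \<comment> \<open>Reflection turns the interval into one open at 0 and closed at 1, so the two
      integrands may differ at the endpoints.\<close>
    have "AE x in lborel. x \<noteq> (0::real)" "AE x in lborel. x \<noteq> (1::real)"
      by (rule AE_lborel_singleton)+
    then show "AE x in lborel. f (1 + - 1 * x) * indicator {0..<1} (1 + - 1 * x) = f (- x) * indicator {0..<1} x"
    proof eventually_elim
      case (elim x)
      then show ?case
        using per[of "- x"] by (auto simp: indicator_def)
    qed
  qed
  finally show ?thesis ..
qed

text \<open>Multiplication by \<open>n\<close> wraps the circle \<open>n\<close> times around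
  itself: substitution produces \<open>n\<close> unit periods, and the Jacobian cancels this factor.
  Negative multipliers reduce to positive ones by reflection.\<close>

lemma circle_integral_scale:
  fixes f :: "real \<Rightarrow> ennreal" and k :: int
  assumes [measurable]: "f \<in> borel_measurable borel" and per: "\<And>x. f (x + 1) = f x"
    and "k \<noteq> 0"
  shows "circle_integral (\<lambda>x. f (of_int k * x)) = circle_integral f"
proof -
  have pos: "circle_integral (\<lambda>x. f (real n * x)) = circle_integral f" if "n > 0" for n :: nat
  proof -
    have "ennreal (real n) * circle_integral (\<lambda>x. f (real n * x))
       = ennreal (real n) * (\<integral>\<^sup>+x. f (real n * x) * indicator {0..<real n} (real n * x) \<partial>lborel)"
      unfolding circle_integral_def using that
      by (intro arg_cong[of _ _ "\<lambda>y. ennreal (real n) * y"] nn_integral_cong) (auto simp: indicator_def zero_le_mult_iff)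
    also have "\<dots> = (\<integral>\<^sup>+x. f x * indicator {0..<real n} x \<partial>lborel)"
      using nn_integral_real_affine[of "\<lambda>x. f x * indicator {0..<real n} x" "real n" 0] that by simp
    also have "\<dots> = (\<integral>\<^sup>+x. (\<Sum>j<n. f x * indicator {real_of_int (int j)..<real_of_int (int j) + 1} x) \<partial>lborel)"
    proof (intro nn_integral_cong)
      fix x :: real
      have "(\<Sum>j<n. indicator {real_of_int (int j)..<real_of_int (int j) + 1} x) = (indicator {0..<real n} x :: ennreal)"
      proof (induction n)
        case (Suc n)
        then show ?case
          by (auto simp: indicator_def split: if_splits)
      qed simp
      then show "f x * indicator {0..<real n} x
          = (\<Sum>j<n. f x * indicator {real_of_int (int j)..<real_of_int (int j) + 1} x)"
        by (simp add: sum_distrib_left[symmetric])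
    qed
    also have "\<dots> = (\<Sum>j<n. \<integral>\<^sup>+x. f x * indicator {real_of_int (int j)..<real_of_int (int j) + 1} x \<partial>lborel)"
      by (rule nn_integral_sum) auto
    also have "\<dots> = ennreal (real n) * circle_integral f"
      unfolding circle_integral_int_interval[OF assms(1) per]
      by (simp add: ennreal_of_nat_eq_real_of_nat)
    finally show ?thesis
      using that by (simp add: ennreal_mult_cancel_left)
  qed
  show ?thesis
  proof (cases "k > 0")
    case True
    then show ?thesis
      using pos[of "nat k"] by simp
  next
    case False
    have "circle_integral (\<lambda>x. f (of_int k * x)) = circle_integral (\<lambda>x. f (real (nat (- k)) * (- x)))"
      using False by simp
    also have "\<dots> = circle_integral (\<lambda>x. f (real (nat (- k)) * x))"
    proof (rule circle_integral_uminus)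
      show "f (real (nat (- k)) * (x + 1)) = f (real (nat (- k)) * x)" for x
        using periodic_int[of f "real (nat (- k)) * x" "- k", OF per] False by (simp add: algebra_simps)
    qed simp
    also have "\<dots> = circle_integral f"
      using pos[of "nat (- k)"] False \<open>k \<noteq> 0\<close> by simp
    finally show ?thesis .
  qed
qed

lemma circle_integral_affine:
  fixes f :: "real \<Rightarrow> ennreal" and k :: int
  assumes [measurable]: "f \<in> borel_measurable borel" and per: "\<And>x. f (x + 1) = f x"
    and "k \<noteq> 0"
  shows "circle_integral (\<lambda>x. f (of_int k * x + c)) = circle_integral f"
proof -
  have "circle_integral (\<lambda>x. f (of_int k * x + c)) = circle_integral (\<lambda>x. f (x + c))"
    using per[of "_ + c"] by (intro circle_integral_scale \<open>k \<noteq> 0\<close>) (auto simp: algebra_simps)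
  then show ?thesis
    using circle_integral_shift[OF assms(1) per] by simp
qed

lemma circle_integral_cmult:
  fixes f :: "real \<Rightarrow> ennreal"
  assumes [measurable]: "f \<in> borel_measurable borel"
  shows "circle_integral (\<lambda>x. c * f x) = c * circle_integral f"
  unfolding circle_integral_def by (simp add: mult.assoc nn_integral_cmult)

lemma circle_integral_multc:
  fixes f :: "real \<Rightarrow> ennreal"
  assumes [measurable]: "f \<in> borel_measurable borel"
  shows "circle_integral (\<lambda>x. f x * c) = circle_integral f * c"
  using circle_integral_cmult[OF assms, of c] by (simp add: mult.commute)

lemma circle_integral_const: "circle_integral (\<lambda>x. c) = c"
  unfolding circle_integral_def by (simp add: nn_integral_cmult_indicator)

section \<open>Linear forms on the torus\<close>

definition torus_integral :: "(real \<times> real \<Rightarrow> ennreal) \<Rightarrow> ennreal" where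
  "torus_integral F = (\<integral>\<^sup>+z. F z * indicator ({0..<1} \<times> {0..<1}) z \<partial>lborel)"

lemma borel_measurable_real_fst [measurable]: "fst \<in> borel_measurable (borel :: (real \<times> real) measure)"
  by (intro borel_measurable_continuous_onI continuous_intros)

lemma borel_measurable_real_snd [measurable]: "snd \<in> borel_measurable (borel :: (real \<times> real) measure)"
  by (intro borel_measurable_continuous_onI continuous_intros)

text \<open>Both orders are needed, since a linear form may involve only one of the
  coordinates.\<close>

lemma torus_integral_iterated:
  assumes [measurable]: "F \<in> borel_measurable borel"
  shows "torus_integral F = circle_integral (\<lambda>y. circle_integral (\<lambda>x. F (x, y)))"
    and "torus_integral F = circle_integral (\<lambda>x. circle_integral (\<lambda>y. F (x, y)))"
proof -
  have [measurable]: "F \<in> borel_measurable (lborel \<Otimes>\<^sub>M lborel)"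
    using assms by (simp add: lborel_prod)
  have [measurable]: "{0..<1} \<times> {0..<1} \<in> sets ((lborel :: real measure) \<Otimes>\<^sub>M (lborel :: real measure))"
    by (intro pair_measureI) auto
  have T: "torus_integral F = (\<integral>\<^sup>+z. F z * indicator ({0..<1} \<times> {0..<1}) z \<partial>(lborel \<Otimes>\<^sub>M lborel))"
    unfolding torus_integral_def lborel_prod ..
  show "torus_integral F = circle_integral (\<lambda>y. circle_integral (\<lambda>x. F (x, y)))"
    unfolding T
    by (subst lborel_pair.nn_integral_snd[symmetric])
       (auto simp: circle_integral_def indicator_times mult_ac nn_integral_cmult[symmetric] intro!: nn_integral_cong)
  show "torus_integral F = circle_integral (\<lambda>x. circle_integral (\<lambda>y. F (x, y)))"
    unfolding T
    by (subst lborel.nn_integral_fst[symmetric])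
       (auto simp: circle_integral_def indicator_times mult_ac nn_integral_cmult[symmetric] intro!: nn_integral_cong)
qed

text \<open>Integrating first over a coordinate with nonzero coefficient gives a value that no
  longer depends on the other coordinate.\<close>

lemma torus_integral_linear_form:
  fixes f :: "real \<Rightarrow> ennreal" and v :: "int \<times> int"
  assumes [measurable]: "f \<in> borel_measurable borel" and per: "\<And>x. f (x + 1) = f x"
    and "v \<noteq> (0, 0)"
  shows "torus_integral (\<lambda>z. f (of_int (fst v) * fst z + of_int (snd v) * snd z)) = circle_integral f"
proof (cases "fst v = 0")
  case False
  then show ?thesis
    using circle_integral_affine[OF assms(1) per False]
    by (subst torus_integral_iterated(1)) (auto simp: circle_integral_const)
next
  case True
  then have "snd v \<noteq> 0"
    using \<open>v \<noteq> (0, 0)\<close> by (metis prod.collapse)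
  then show ?thesis
    using circle_integral_affine[OF assms(1) per \<open>snd v \<noteq> 0\<close>]
    by (subst torus_integral_iterated(2)) (auto simp: circle_integral_const add.commute)
qed

text \<open>Shearing the first coordinate removes the second variable from the argument of
  \<open>f\<close>; then \<open>g\<close> can be averaged over that variable alone, its coefficient
  there being the determinant up to scaling. The case \<open>a = 0\<close> needs no shear.\<close>

lemma torus_integral_independent:
  fixes f g :: "real \<Rightarrow> ennreal" and a b c d :: int
  assumes [measurable]: "f \<in> borel_measurable borel" "g \<in> borel_measurable borel"
    and perf: "\<And>x. f (x + 1) = f x" and perg: "\<And>x. g (x + 1) = g x"
    and det: "a * d \<noteq> b * c"
  shows "torus_integral (\<lambda>z. f (of_int a * fst z + of_int b * snd z) * g (of_int c * fst z + of_int d * snd z))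
     = circle_integral f * circle_integral g"
proof (cases "a = 0")
  case True
  then have "b \<noteq> 0" "c \<noteq> 0"
    using det by auto
  have "torus_integral (\<lambda>z. f (of_int a * fst z + of_int b * snd z) * g (of_int c * fst z + of_int d * snd z))
     = circle_integral (\<lambda>y. f (of_int b * y) * circle_integral (\<lambda>x. g (of_int c * x + of_int d * y)))"
    by (subst torus_integral_iterated(1)) (auto simp: True circle_integral_cmult)
  also have "\<dots> = circle_integral f * circle_integral g"
    unfolding circle_integral_affine[OF assms(2) perg \<open>c \<noteq> 0\<close>]
    by (simp add: circle_integral_multc circle_integral_scale[OF assms(1) perf \<open>b \<noteq> 0\<close>])
  finally show ?thesis .
next
  case a: False
  define \<Delta> where "\<Delta> = a * d - b * c"
  have "\<Delta> \<noteq> 0"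
    using det unfolding \<Delta>_def by simp
  have fi: "f (x + of_int m) = f x" and gi: "g (x + of_int m) = g x" for x m
    using periodic_int[of f, OF perf] periodic_int[of g, OF perg] by auto
  define \<Phi> where "\<Phi> y = circle_integral (\<lambda>x. f (of_int a * x + of_int b * y) * g (of_int c * x + of_int d * y))" for y
  have \<Phi>: "\<Phi> y = circle_integral (\<lambda>x. f (of_int a * x) * g (of_int c * x + of_int \<Delta> / of_int a * y))" for y
  proof -
    let ?h = "\<lambda>x. f (of_int a * x + of_int b * y) * g (of_int c * x + of_int d * y)"
    have "?h (x + 1) = ?h x" for x
      using fi[of "of_int a * x + of_int b * y" a] gi[of "of_int c * x + of_int d * y" c]
      by (simp add: algebra_simps)
    then have "\<Phi> y = circle_integral (\<lambda>x. ?h (x + (- of_int b / of_int a * y)))"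
      unfolding \<Phi>_def by (intro circle_integral_shift[symmetric]) auto
    also have "(\<lambda>x. ?h (x + (- of_int b / of_int a * y))) = (\<lambda>x. f (of_int a * x) * g (of_int c * x + of_int \<Delta> / of_int a * y))"
      using a unfolding \<Delta>_def by (auto simp: field_simps)
    finally show ?thesis .
  qed
  have \<Phi>_per: "\<Phi> (y + 1) = \<Phi> y" for y
  proof -
    have "f (of_int a * x + of_int b * (y + 1)) = f (of_int a * x + of_int b * y)"
         "g (of_int c * x + of_int d * (y + 1)) = g (of_int c * x + of_int d * y)" for x
      using fi[of "of_int a * x + of_int b * y" b] gi[of "of_int c * x + of_int d * y" d]
      by (simp_all add: algebra_simps)
    then show ?thesis
      unfolding \<Phi>_def by simp
  qed
  have [measurable]: "\<Phi> \<in> borel_measurable borel"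
    unfolding \<Phi>_def circle_integral_def by measurable
  have "torus_integral (\<lambda>z. f (of_int a * fst z + of_int b * snd z) * g (of_int c * fst z + of_int d * snd z))
     = circle_integral \<Phi>"
    unfolding \<Phi>_def by (subst torus_integral_iterated(1)) auto
  \<comment> \<open>The shear leaves the coefficient \<Delta>/a, in general not an integer. The
    inner integral is still 1-periodic in \<open>y\<close>, so \<open>y\<close> may be replaced by
    \<open>a * y\<close>, which clears the denominator.\<close>
  also have "\<dots> = circle_integral (\<lambda>y. \<Phi> (of_int a * y))"
    by (rule circle_integral_scale[symmetric]) (auto simp: \<Phi>_per a)
  also have "\<dots> = circle_integral (\<lambda>y. circle_integral (\<lambda>x. f (of_int a * x) * g (of_int c * x + of_int \<Delta> * y)))"
    unfolding \<Phi> using a by simp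
  also have "\<dots> = torus_integral (\<lambda>z. f (of_int a * fst z) * g (of_int c * fst z + of_int \<Delta> * snd z))"
    by (subst torus_integral_iterated(1)) auto
  also have "\<dots> = circle_integral (\<lambda>x. f (of_int a * x) * circle_integral (\<lambda>y. g (of_int \<Delta> * y + of_int c * x)))"
    by (subst torus_integral_iterated(2)) (auto simp: circle_integral_cmult add.commute)
  also have "\<dots> = circle_integral f * circle_integral g"
    unfolding circle_integral_affine[OF assms(2) perg \<open>\<Delta> \<noteq> 0\<close>]
    by (simp add: circle_integral_multc circle_integral_scale[OF assms(1) perf a])
  finally show ?thesis .
qed

section \<open>Overlaps of strips\<close>

text \<open>A count and not an indicator: half-integers have two integers at distance 1/2, and
  averaging over shifts leads to radii \<open>real a * r\<close> of any size.\<close>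

definition near_count :: "real \<Rightarrow> real \<Rightarrow> nat" where
  "near_count r y = card {p::int. \<bar>y - of_int p\<bar> \<le> r}"

lemma near_integers_eq: "{p::int. \<bar>y - of_int p\<bar> \<le> r} = {\<lceil>y - r\<rceil>..\<lfloor>y + r\<rfloor>}"
  by (auto simp: le_floor_iff ceiling_le_iff abs_le_iff)

lemma near_count_eq:
  assumes "r \<ge> 0"
  shows "real (near_count r y) = of_int (\<lfloor>y + r\<rfloor> - \<lceil>y - r\<rceil> + 1)"
proof -
  have "\<lfloor>y + r\<rfloor> - \<lceil>y - r\<rceil> + 1 \<ge> 0"
    using assms by linarith
  then show ?thesis
    unfolding near_count_def near_integers_eq by simp
qed

lemma near_count_le: "r \<ge> 0 \<Longrightarrow> real (near_count r y) \<le> 2 * r + 1"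
  by (simp add: near_count_eq) linarith

lemma near_count_add_1: "near_count r (y + 1) = near_count r y"
proof -
  have "\<lceil>y + 1 - r\<rceil> = \<lceil>y - r\<rceil> + 1" "\<lfloor>y + 1 + r\<rfloor> = \<lfloor>y + r\<rfloor> + 1"
    by linarith+
  then show ?thesis
    unfolding near_count_def near_integers_eq by simp
qed

lemma near_count_add_int: "near_count r (y + of_int m) = near_count r y"
  by (rule periodic_int[of "near_count r"]) (rule near_count_add_1)

lemma borel_measurable_near_count [measurable]:
  "(\<lambda>y. real (near_count r y)) \<in> borel_measurable borel"
proof (cases "r \<ge> 0")
  case True
  then show ?thesis
    unfolding near_count_eq[OF True] by measurable
next
  case False
  then have "{p::int. \<bar>y - of_int p\<bar> \<le> r} = {}" for y
    by (auto simp: not_le intro: less_le_trans)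
  then have "near_count r y = 0" for y
    unfolding near_count_def by simp
  then show ?thesis
    by simp
qed

lemma circle_integral_near_count:
  assumes "0 \<le> r" "r \<le> 1/2"
  shows "circle_integral (\<lambda>y. ennreal (real (near_count r y))) = ennreal (2 * r)"
proof -
  \<comment> \<open>For r \<le> 1/2 only the integers 0 and 1 are in reach of the unit interval. The
    two indicators are added, not merged, since at r = 1/2 their supports share a point.\<close>
  have "ennreal (real (near_count r y)) * indicator {0..<1} y = indicator {1 - r..<1} y + indicator {0..r} y" for y
  proof (cases "y \<in> {0..<1}")
    case True
    have "\<lfloor>y + r\<rfloor> = (if y \<ge> 1 - r then 1 else 0)"
      using True assms by (auto simp: floor_eq_iff)
    moreover have "\<lceil>y - r\<rceil> = (if y \<le> r then 0 else 1)"
      using True assms by (auto simp: ceiling_eq_iff)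
    ultimately have "real (near_count r y) = indicator {1 - r..<1} y + indicator {0..r} y"
      using True assms by (auto simp: near_count_eq indicator_def)
    then show ?thesis
      using True by (auto simp: indicator_def)
  next
    case False
    then show ?thesis
      using assms by (auto simp: indicator_def)
  qed
  then have "circle_integral (\<lambda>y. ennreal (real (near_count r y)))
      = (\<integral>\<^sup>+y. indicator {1 - r..<1} y + indicator {0..r} y \<partial>lborel)"
    unfolding circle_integral_def by simp
  also have "\<dots> = emeasure lborel {1 - r..<1} + emeasure lborel {0..r}"
    by (subst nn_integral_add) auto
  also have "\<dots> = ennreal (2 * r)"
    using assms by (simp add: ennreal_plus[symmetric] del: ennreal_plus)
  finally show ?thesis .
qed

text \<open>After multiplication by \<open>a\<close> the pairs (j, p) become integers ap - bj within
  ar of ay, and coprimality keeps them distinct, because such an integer determines j modulo a. The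
  rounding error + 1 is thus paid once for all \<open>a\<close> shifts, which is the origin of the
  gain 1/a in the covariance.\<close>

lemma sum_near_count_le:
  fixes a :: nat and b :: int
  assumes "a > 0" "coprime (int a) b" "r \<ge> 0"
  shows "(\<Sum>j<a. real (near_count r (y + of_int b * real j / real a))) \<le> 2 * real a * r + 1"
proof -
  define P where "P j = {p::int. \<bar>y + of_int b * real j / real a - of_int p\<bar> \<le> r}" for j :: nat
  have finP: "finite (P j)" for j
    unfolding P_def near_integers_eq by simp
  let ?h = "\<lambda>(j, p). int a * p - b * int j"
  have "inj_on ?h (Sigma {..<a} P)"
  proof (rule inj_onI, clarify)
    fix j p j' p'
    assume jj: "j < a" "j' < a" and eq: "int a * p - b * int j = int a * p' - b * int j'"
    then have "b * (int j - int j') = int a * (p - p')"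
      by (simp add: algebra_simps)
    then have "int a dvd b * (int j - int j')"
      by simp
    then have dvd: "int a dvd int j - int j'"
      using assms(2) coprime_dvd_mult_right_iff by blast
    have "j = j'"
    proof (rule ccontr)
      assume "j \<noteq> j'"
      then have "int a \<le> \<bar>int j - int j'\<bar>"
        using dvd_imp_le_int[OF _ dvd] by simp
      then show False
        using jj by linarith
    qed
    then show "j = j' \<and> p = p'"
      using eq assms(1) by simp
  qed
  moreover have "?h ` Sigma {..<a} P \<subseteq> {m. \<bar>real a * y - of_int m\<bar> \<le> real a * r}"
  proof clarify
    fix j p assume "p \<in> P j"
    then have "real a * \<bar>y + of_int b * real j / real a - of_int p\<bar> \<le> real a * r"
      unfolding P_def by (intro mult_left_mono) auto
    also have "real a * \<bar>y + of_int b * real j / real a - of_int p\<bar>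
        = \<bar>real a * (y + of_int b * real j / real a - of_int p)\<bar>"
      by (simp add: abs_mult)
    also have "real a * (y + of_int b * real j / real a - of_int p) = real a * y - of_int (int a * p - b * int j)"
      using assms(1) by (simp add: field_simps)
    finally show "\<bar>real a * y - of_int (int a * p - b * int j)\<bar> \<le> real a * r" .
  qed
  ultimately have "card (Sigma {..<a} P) \<le> near_count (real a * r) (real a * y)"
    unfolding near_count_def
    by (intro card_inj_on_le) (auto simp: near_integers_eq)
  moreover have "card (Sigma {..<a} P) = (\<Sum>j<a. near_count r (y + of_int b * real j / real a))"
    using finP unfolding near_count_def P_def by (subst card_SigmaI) auto
  ultimately have "(\<Sum>j<a. real (near_count r (y + of_int b * real j / real a))) \<le> real (near_count (real a * r) (real a * y))"
    by (simp flip: of_nat_sum)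
  also have "\<dots> \<le> 2 * real a * r + 1"
    using near_count_le[of "real a * r" "real a * y"] assms(3) by (simp add: mult.assoc)
  finally show ?thesis .
qed

text \<open>Averaging over the shifts by \<open>j / a\<close> fixes the first factor, while the shifted second
  factors are spread evenly because \<open>a\<close> and \<open>b\<close> are coprime.\<close>

lemma circle_integral_overlap_le:
  fixes a :: nat and b :: int
  assumes "a > 0" "coprime (int a) b" "0 \<le> r" "r \<le> 1/2" "0 \<le> r'"
  shows "circle_integral (\<lambda>x. ennreal (real (near_count r (real a * x - \<gamma>)) * real (near_count r' (of_int b * x - \<gamma>))))
     \<le> ennreal (4 * r * r' + 2 * r / real a)"
proof -
  define F where "F x = real (near_count r (real a * x - \<gamma>)) * real (near_count r' (of_int b * x - \<gamma>))" for x
  have [measurable]: "F \<in> borel_measurable borel"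
    unfolding F_def by measurable
  have per: "F (x + 1) = F x" for x
    using near_count_add_int[of r "real a * x - \<gamma>" "int a"] near_count_add_int[of r' "of_int b * x - \<gamma>" b]
    unfolding F_def by (simp add: algebra_simps)
  define B where "B = 2 * real a * r' + 1"
  have "B \<ge> 0"
    unfolding B_def using assms by simp
  have "ennreal (real a) * circle_integral (\<lambda>x. ennreal (F x))
      = (\<Sum>j<a. circle_integral (\<lambda>x. ennreal (F (x + real j / real a))))"
  proof -
    have "circle_integral (\<lambda>x. ennreal (F (x + real j / real a))) = circle_integral (\<lambda>x. ennreal (F x))" for j
      by (rule circle_integral_shift[of "\<lambda>x. ennreal (F x)"]) (auto simp: per)
    then show ?thesis
      by (simp add: ennreal_of_nat_eq_real_of_nat)
  qed
  also have "\<dots> = circle_integral (\<lambda>x. \<Sum>j<a. ennreal (F (x + real j / real a)))"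
    unfolding circle_integral_def sum_distrib_right by (rule nn_integral_sum[symmetric]) measurable
  also have "\<dots> \<le> circle_integral (\<lambda>x. ennreal (real (near_count r (real a * x - \<gamma>))) * ennreal B)"
    unfolding circle_integral_def
  proof (intro nn_integral_mono mult_right_mono)
    fix x :: real
    have "F (x + real j / real a) = real (near_count r (real a * x - \<gamma>))
        * real (near_count r' ((of_int b * x - \<gamma>) + of_int b * real j / real a))" for j
      using near_count_add_int[of r "real a * x - \<gamma>" "int j"] assms(1)
      unfolding F_def by (simp add: algebra_simps)
    then have "(\<Sum>j<a. ennreal (F (x + real j / real a))) = ennreal (real (near_count r (real a * x - \<gamma>))
        * (\<Sum>j<a. real (near_count r' ((of_int b * x - \<gamma>) + of_int b * real j / real a))))"
      by (simp add: sum_ennreal sum_distrib_left)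
    also have "\<dots> \<le> ennreal (real (near_count r (real a * x - \<gamma>)) * B)"
      unfolding B_def using assms by (intro ennreal_leI mult_left_mono sum_near_count_le) auto
    also have "\<dots> = ennreal (real (near_count r (real a * x - \<gamma>))) * ennreal B"
      using \<open>B \<ge> 0\<close> by (simp add: ennreal_mult)
    finally show "(\<Sum>j<a. ennreal (F (x + real j / real a)))
        \<le> ennreal (real (near_count r (real a * x - \<gamma>))) * ennreal B" .
  qed simp
  also have "\<dots> = circle_integral (\<lambda>x. ennreal (real (near_count r (of_int (int a) * x + (- \<gamma>))))) * ennreal B"
    by (subst circle_integral_multc) auto
  also have "\<dots> = ennreal (2 * r) * ennreal B"
    using assms(1,3,4) near_count_add_1
    by (subst circle_integral_affine[of "\<lambda>y. ennreal (real (near_count r y))"])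
       (auto simp: circle_integral_near_count)
  also have "\<dots> = ennreal (real a) * ennreal (4 * r * r' + 2 * r / real a)"
  proof -
    have "2 * r * B = real a * (4 * r * r' + 2 * r / real a)"
      unfolding B_def using assms(1) by (simp add: field_simps)
    then show ?thesis
      using \<open>B \<ge> 0\<close> assms by (simp add: ennreal_mult[symmetric] del: ennreal_plus)
  qed
  finally have "ennreal (real a) * circle_integral (\<lambda>x. ennreal (F x))
      \<le> ennreal (real a) * ennreal (4 * r * r' + 2 * r / real a)" .
  then show ?thesis
    using assms(1) unfolding F_def by (simp add: ennreal_mult_le_mult_iff)
qed

text \<open>In \<open>b\<close> times the first condition minus \<open>a\<close> times the second,
  \<open>x\<close> cancels, and what remains is (a - b)\<gamma> up to an integer.\<close>

lemma near_count_overlap_imp: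
  fixes a :: nat and b :: int
  assumes "near_count r (real a * x - \<gamma>) \<noteq> 0" "near_count r' (of_int b * x - \<gamma>) \<noteq> 0"
  shows "\<exists>p::int. \<bar>of_int (int a - b) * \<gamma> - of_int p\<bar> \<le> real_of_int \<bar>b\<bar> * r + real a * r'"
proof -
  obtain p p' :: int where p: "\<bar>real a * x - \<gamma> - of_int p\<bar> \<le> r" and p': "\<bar>of_int b * x - \<gamma> - of_int p'\<bar> \<le> r'"
    using assms unfolding near_count_def by (auto simp: card_eq_0_iff)
  have "\<bar>real_of_int b * (real a * x - \<gamma> - of_int p)\<bar> \<le> real_of_int \<bar>b\<bar> * r"
    using p by (simp add: abs_mult mult_left_mono)
  moreover have "\<bar>real a * (of_int b * x - \<gamma> - of_int p')\<bar> \<le> real a * r'"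
    using p' by (simp add: abs_mult mult_left_mono)
  moreover have "of_int (int a - b) * \<gamma> - of_int (b * p - int a * p')
      = real_of_int b * (real a * x - \<gamma> - of_int p) - real a * (of_int b * x - \<gamma> - of_int p')"
    by (simp add: algebra_simps)
  ultimately have "\<bar>of_int (int a - b) * \<gamma> - of_int (b * p - int a * p')\<bar> \<le> real_of_int \<bar>b\<bar> * r + real a * r'"
    by linarith
  then show ?thesis ..
qed

section \<open>Moments of the hit counts on the torus\<close>

definition torus_measure :: "(real \<times> real) measure" where
  "torus_measure = restrict_space lborel ({0..<1} \<times> {0..<1})"

lemma unit_square_sets: "{0..<1::real} \<times> {0..<1::real} \<in> sets borel"
  by (simp add: borel_Times)

lemma nn_integral_torus_measure: "(\<integral>\<^sup>+z. F z \<partial>torus_measure) = torus_integral F"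
  unfolding torus_measure_def torus_integral_def
  using unit_square_sets by (simp add: nn_integral_restrict_space)

lemma prob_space_torus_measure: "emeasure torus_measure (space torus_measure) = 1"
proof -
  have "emeasure torus_measure (space torus_measure) = torus_integral (\<lambda>z. 1)"
    unfolding nn_integral_torus_measure[symmetric] by simp
  also have "\<dots> = 1"
    by (subst torus_integral_iterated(1)) (auto simp: circle_integral_const)
  finally show ?thesis .
qed

interpretation torus: finite_measure torus_measure
  by (rule finite_measureI) (simp add: prob_space_torus_measure)

lemma measurable_torusI: "f \<in> borel_measurable borel \<Longrightarrow> f \<in> borel_measurable torus_measure"
  unfolding torus_measure_def by (intro measurable_restrict_space1) simp

definition hits :: "real \<Rightarrow> real \<Rightarrow> int \<times> int \<Rightarrow> real \<times> real \<Rightarrow> real" where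
  "hits \<gamma> r q z = real (near_count r (of_int (fst q) * fst z + of_int (snd q) * snd z - \<gamma>))"

lemma borel_measurable_hits [measurable]: "hits \<gamma> r q \<in> borel_measurable torus_measure"
  unfolding hits_def by (intro measurable_torusI) measurable

lemma hits_nonneg: "hits \<gamma> r q z \<ge> 0"
  unfolding hits_def by simp

lemma hits_le: "r \<ge> 0 \<Longrightarrow> hits \<gamma> r q z \<le> 2 * r + 1"
  unfolding hits_def by (rule near_count_le)

lemma integrable_hits: "r \<ge> 0 \<Longrightarrow> integrable torus_measure (hits \<gamma> r q)"
  by (intro torus.integrable_const_bound[of _ "2 * r + 1"]) (simp_all add: hits_nonneg hits_le)

lemma integrable_hits_mult:
  assumes "r \<ge> 0" "r' \<ge> 0"
  shows "integrable torus_measure (\<lambda>z. hits \<gamma> r q z * hits \<gamma> r' q' z)"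
proof (rule torus.integrable_const_bound)
  show "AE z in torus_measure. norm (hits \<gamma> r q z * hits \<gamma> r' q' z) \<le> (2 * r + 1) * (2 * r' + 1)"
  proof (rule AE_I2)
    fix z
    show "norm (hits \<gamma> r q z * hits \<gamma> r' q' z) \<le> (2 * r + 1) * (2 * r' + 1)"
      using mult_mono[OF hits_le[OF assms(1), of \<gamma> q z] hits_le[OF assms(2), of \<gamma> q' z]] assms
      by (simp add: hits_nonneg)
  qed
qed measurable

lemma shifted_near_count_add_1: "ennreal (real (near_count r (x + 1 - \<gamma>))) = ennreal (real (near_count r (x - \<gamma>)))"
  using near_count_add_1[of r "x - \<gamma>"] by (simp add: algebra_simps)

lemma circle_integral_shifted_near_count:
  assumes "0 \<le> r" "r \<le> 1/2"
  shows "circle_integral (\<lambda>y. ennreal (real (near_count r (y - \<gamma>)))) = ennreal (2 * r)"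
  using circle_integral_shift[of "\<lambda>y. ennreal (real (near_count r y))" "- \<gamma>"] near_count_add_1
    circle_integral_near_count[OF assms] by simp

lemma integral_hits:
  assumes "0 \<le> r" "r \<le> 1/2" "q \<noteq> (0, 0)"
  shows "(\<integral>z. hits \<gamma> r q z \<partial>torus_measure) = 2 * r"
proof -
  have "(\<integral>\<^sup>+z. ennreal (hits \<gamma> r q z) \<partial>torus_measure) = ennreal (2 * r)"
    unfolding nn_integral_torus_measure hits_def
    using torus_integral_linear_form[of "\<lambda>y. ennreal (real (near_count r (y - \<gamma>)))" q] assms
    by (simp add: shifted_near_count_add_1 circle_integral_shifted_near_count)
  then show ?thesis
    using assms by (simp add: integral_eq_nn_integral hits_nonneg)
qed

lemma integral_hits_mult_independent:
  assumes "0 \<le> r" "r \<le> 1/2" "0 \<le> r'" "r' \<le> 1/2" "fst q * snd q' \<noteq> snd q * fst q'"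
  shows "(\<integral>z. hits \<gamma> r q z * hits \<gamma> r' q' z \<partial>torus_measure) = 4 * r * r'"
proof -
  have "(\<integral>\<^sup>+z. ennreal (hits \<gamma> r q z * hits \<gamma> r' q' z) \<partial>torus_measure) = ennreal (2 * r) * ennreal (2 * r')"
    unfolding nn_integral_torus_measure hits_def
    using torus_integral_independent[of "\<lambda>y. ennreal (real (near_count r (y - \<gamma>)))"
        "\<lambda>y. ennreal (real (near_count r' (y - \<gamma>)))" "fst q" "snd q'" "snd q" "fst q'"] assms
    by (simp add: shifted_near_count_add_1 circle_integral_shifted_near_count ennreal_mult)
  also have "\<dots> = ennreal (4 * r * r')"
    using assms by (simp add: ennreal_mult[symmetric])
  finally show ?thesis
    using assms by (simp add: integral_eq_nn_integral hits_nonneg)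
qed

lemma hits_multiple:
  "hits \<gamma> r (k * fst v, k * snd v) z
    = real (near_count r (of_int k * (of_int (fst v) * fst z + of_int (snd v) * snd z) - \<gamma>))"
  unfolding hits_def by (simp add: algebra_simps)

text \<open>Both counts see \<open>z\<close> only through the linear form of \<open>v\<close>, so
  this is the overlap on the circle. For radii at most 1/2 the term \<open>4 * r * r'\<close> is the
  product of the means, which leaves \<open>2 * r / real a\<close> as a bound for the
  covariance.\<close>

lemma integral_hits_mult_parallel_le:
  fixes a :: nat and b :: int
  assumes "0 \<le> r" "r \<le> 1/2" "0 \<le> r'" "v \<noteq> (0, 0)" "a > 0" "coprime (int a) b"
    "q = (int a * fst v, int a * snd v)" "q' = (b * fst v, b * snd v)"
  shows "(\<integral>z. hits \<gamma> r q z * hits \<gamma> r' q' z \<partial>torus_measure) \<le> 4 * r * r' + 2 * r / real a"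
proof -
  let ?f = "\<lambda>x. ennreal (real (near_count r (real a * x - \<gamma>)) * real (near_count r' (of_int b * x - \<gamma>)))"
  have "?f (x + 1) = ?f x" for x
    using near_count_add_int[of r "real a * x - \<gamma>" "int a"] near_count_add_int[of r' "of_int b * x - \<gamma>" b]
    by (simp add: algebra_simps)
  then have "(\<integral>\<^sup>+z. ennreal (hits \<gamma> r q z * hits \<gamma> r' q' z) \<partial>torus_measure) = circle_integral ?f"
    unfolding nn_integral_torus_measure assms(7,8) hits_multiple
    using torus_integral_linear_form[of ?f v] assms(4) by simp
  also have "\<dots> \<le> ennreal (4 * r * r' + 2 * r / real a)"
    by (rule circle_integral_overlap_le) (use assms in auto)
  finally have "(\<integral>\<^sup>+z. ennreal (hits \<gamma> r q z * hits \<gamma> r' q' z) \<partial>torus_measure) \<le> ennreal (4 * r * r' + 2 * r / real a)" .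
  then show ?thesis
    using assms by (simp add: integral_eq_nn_integral hits_nonneg enn2real_leI)
qed

text \<open>The strips are then disjoint, so the product vanishes at every point. The use is
  contrapositive: a nonzero mean product forces (a - b)\<gamma> to be near an integer.\<close>

lemma integral_hits_mult_parallel_eq_0:
  fixes a :: nat and b :: int
  assumes "q = (int a * fst v, int a * snd v)" "q' = (b * fst v, b * snd v)"
    and far: "\<And>p::int. \<bar>of_int (int a - b) * \<gamma> - of_int p\<bar> > real_of_int \<bar>b\<bar> * r + real a * r'"
  shows "(\<integral>z. hits \<gamma> r q z * hits \<gamma> r' q' z \<partial>torus_measure) = 0"
proof -
  have zero: "hits \<gamma> r q z * hits \<gamma> r' q' z = 0" for z
  proof (rule ccontr)
    define x where "x = real_of_int (fst v) * fst z + real_of_int (snd v) * snd z"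
    assume "hits \<gamma> r q z * hits \<gamma> r' q' z \<noteq> 0"
    then have "near_count r (real a * x - \<gamma>) \<noteq> 0" "near_count r' (of_int b * x - \<gamma>) \<noteq> 0"
      unfolding assms(1,2) hits_multiple x_def by auto
    then show False
      using near_count_overlap_imp far by (meson not_le)
  qed
  show ?thesis
    unfolding zero by simp
qed

lemma (in finite_measure) second_moment_centred_sum:
  fixes X :: "'i \<Rightarrow> 'a \<Rightarrow> real"
  assumes "finite S" "measure M (space M) = 1"
    and int: "\<And>i. i \<in> S \<Longrightarrow> integrable M (X i)"
    and int2: "\<And>i j. i \<in> S \<Longrightarrow> j \<in> S \<Longrightarrow> integrable M (\<lambda>x. X i x * X j x)"
    and mean: "\<And>i. i \<in> S \<Longrightarrow> (\<integral>x. X i x \<partial>M) = \<mu> i"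
  shows "integrable M (\<lambda>x. (\<Sum>i\<in>S. X i x - \<mu> i)\<^sup>2)"
    and "(\<integral>x. (\<Sum>i\<in>S. X i x - \<mu> i)\<^sup>2 \<partial>M) = (\<Sum>i\<in>S. \<Sum>j\<in>S. (\<integral>x. X i x * X j x \<partial>M) - \<mu> i * \<mu> j)"
proof -
  have expand: "(\<Sum>i\<in>S. X i x - \<mu> i)\<^sup>2
      = (\<Sum>i\<in>S. \<Sum>j\<in>S. X i x * X j x - \<mu> j * X i x - \<mu> i * X j x + \<mu> i * \<mu> j)" for x
    unfolding power2_eq_square sum_product
    by (intro sum.cong refl) (simp add: algebra_simps)
  have pair: "integrable M (\<lambda>x. X i x * X j x - \<mu> j * X i x - \<mu> i * X j x + \<mu> i * \<mu> j)"
    if "i \<in> S" "j \<in> S" for i j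
    using int int2 that by (intro Bochner_Integration.integrable_add Bochner_Integration.integrable_diff integrable_mult_right) auto
  show "integrable M (\<lambda>x. (\<Sum>i\<in>S. X i x - \<mu> i)\<^sup>2)"
    unfolding expand by (intro Bochner_Integration.integrable_sum pair)
  have "(\<integral>x. X i x * X j x - \<mu> j * X i x - \<mu> i * X j x + \<mu> i * \<mu> j \<partial>M) = (\<integral>x. X i x * X j x \<partial>M) - \<mu> i * \<mu> j"
    if "i \<in> S" "j \<in> S" for i j
    using int int2 that assms(2) mean
    by (subst Bochner_Integration.integral_add Bochner_Integration.integral_diff; simp)+
  then show "(\<integral>x. (\<Sum>i\<in>S. X i x - \<mu> i)\<^sup>2 \<partial>M) = (\<Sum>i\<in>S. \<Sum>j\<in>S. (\<integral>x. X i x * X j x \<partial>M) - \<mu> i * \<mu> j)"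
    unfolding expand using pair
    by (simp add: Bochner_Integration.integral_sum Bochner_Integration.integrable_sum)
qed

section \<open>Parallel vectors\<close>

text \<open>The definition controls only q \<ge> 2; irrationality supplies a positive distance at q
  = 1, which \<open>c\<close> absorbs. Changing the sign of \<open>p\<close> covers negative
  \<open>m\<close>.\<close>

lemma non_liouville_bound:
  assumes "\<gamma> \<notin> \<rat>" "\<not> liouville_number \<gamma>"
  obtains c and \<eta> :: nat where "c > 0"
    "\<And>m p::int. m \<noteq> 0 \<Longrightarrow> c / real_of_int \<bar>m\<bar> ^ \<eta> \<le> \<bar>of_int m * \<gamma> - of_int p\<bar>"
proof -
  obtain \<eta> :: nat where \<eta>: "\<And>q::nat. q \<ge> 2 \<Longrightarrow> int_dist (real q * \<gamma>) > 1 / real q ^ \<eta>"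
    using assms(2) unfolding liouville_number_def by (meson not_le)
  define c where "c = min 1 (int_dist \<gamma>)"
  have "int_dist \<gamma> \<noteq> 0"
    using assms(1) unfolding int_dist_def by (metis Rats_of_int abs_eq_0 eq_iff_diff_eq_0)
  then have "c > 0"
    unfolding c_def int_dist_def by simp
  have int_dist_le: "int_dist x \<le> \<bar>x - of_int p\<bar>" for x and p :: int
    unfolding int_dist_def using round_diff_minimal[of x p] by simp
  have pos: "c / real q ^ \<eta> \<le> int_dist (real q * \<gamma>)" if "q \<ge> 1" for q :: nat
  proof (cases "q = 1")
    case True
    then show ?thesis
      by (simp add: c_def)
  next
    case False
    then have "q \<ge> 2"
      using that by simp
    have "c / real q ^ \<eta> \<le> 1 / real q ^ \<eta>"
      by (intro divide_right_mono) (auto simp: c_def)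
    then show ?thesis
      using \<eta>[OF \<open>q \<ge> 2\<close>] by simp
  qed
  have "c / real_of_int \<bar>m\<bar> ^ \<eta> \<le> \<bar>of_int m * \<gamma> - of_int p\<bar>" if "m \<noteq> 0" for m p :: int
  proof -
    define q where "q = nat \<bar>m\<bar>"
    have q: "q \<ge> 1" "real q = real_of_int \<bar>m\<bar>"
      using that unfolding q_def by auto
    have "\<exists>p'::int. \<bar>real q * \<gamma> - of_int p'\<bar> = \<bar>of_int m * \<gamma> - of_int p\<bar>"
    proof (cases "m > 0")
      case True
      then show ?thesis
        using q by (intro exI[of _ p]) simp
    next
      case False
      then show ?thesis
        using q by (intro exI[of _ "- p"]) simp
    qed
    then show ?thesis
      using pos[OF q(1)] int_dist_le q(2) by (metis order.trans)
  qed
  then show ?thesis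
    using that \<open>c > 0\<close> by blast
qed

text \<open>Here \<open>v\<close> is the norm of a common divisor vector, so that \<open>a * v\<close> and \<open>\<bar>b\<bar> * v\<close> are the norms of
  two parallel vectors.\<close>

definition overlaps_need_large_multiplier :: "real \<Rightarrow> (nat \<Rightarrow> real) \<Rightarrow> real \<Rightarrow> real \<Rightarrow> bool" where
  "overlaps_need_large_multiplier \<gamma> \<psi> c \<kappa> \<longleftrightarrow>
     (\<forall>(a::nat) (b::int) (v::nat) (p::int).
        a > 0 \<and> \<bar>b\<bar> \<le> int a \<and> b \<noteq> int a \<and> b \<noteq> 0 \<and> v > 0 \<and>
        \<bar>of_int (int a - b) * \<gamma> - of_int p\<bar> \<le> real_of_int \<bar>b\<bar> * \<psi> (a * v) + real a * \<psi> (nat \<bar>b\<bar> * v) \<longrightarrow>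
        c * real (a * v) powr \<kappa> \<le> real a)"

text \<open>The Diophantine condition on \<open>\<gamma>\<close> and the decay of \<open>\<psi>\<close> enter only here.\<close>

lemma overlap_multiplier_large:
  fixes \<gamma> \<epsilon> :: real and \<psi> :: "nat \<Rightarrow> real"
  assumes "\<gamma> \<notin> \<rat>" "\<not> liouville_number \<gamma>" "\<epsilon> > 0"
    and \<psi>: "C > 0" "\<And>n. n \<ge> 1 \<Longrightarrow> \<psi> n \<le> C * real n powr (- \<epsilon>)"
  obtains c \<kappa> where "c > 0" "\<kappa> > 0"
    "overlaps_need_large_multiplier \<gamma> \<psi> c \<kappa>"
proof -
  obtain c0 and \<eta> :: nat where c0: "c0 > 0"
    and bound: "\<And>m p::int. m \<noteq> 0 \<Longrightarrow> c0 / real_of_int \<bar>m\<bar> ^ \<eta> \<le> \<bar>of_int m * \<gamma> - of_int p\<bar>"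
    using non_liouville_bound[OF assms(1,2)] by metis
  \<comment> \<open>The chain below yields v^\<epsilon> \<le> B a^(\<eta> + 1). Multiplying by
    a^\<epsilon> replaces v by the norm \<open>a * v\<close>, whence the exponent \<theta>; solving
    for a gives the power \<epsilon>/\<theta>.\<close>
  define \<theta> where "\<theta> = real \<eta> + 1 + \<epsilon>"
  define B where "B = 2 ^ \<eta> * 2 * C / c0"
  have \<theta>: "\<theta> > 0" and "B > 0"
    unfolding \<theta>_def B_def using \<open>\<epsilon> > 0\<close> \<psi>(1) c0 by auto
  have "(1 / B) powr (1 / \<theta>) * real (a * v) powr (\<epsilon> / \<theta>) \<le> real a"
    if a: "a > 0" "\<bar>b\<bar> \<le> int a" "b \<noteq> int a" "b \<noteq> 0" "v > 0"
      and close: "\<bar>of_int (int a - b) * \<gamma> - of_int p\<bar> \<le> real_of_int \<bar>b\<bar> * \<psi> (a * v) + real a * \<psi> (nat \<bar>b\<bar> * v)"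
    for a :: nat and b :: int and v :: nat and p :: int
  proof -
    \<comment> \<open>The shorter vector can have norm as small as \<open>v\<close>, so decay is
      measured in \<open>v\<close> for both vectors.\<close>
    have \<psi>v: "\<psi> (k * v) \<le> C * real v powr (- \<epsilon>)" if "k > 0" for k :: nat
    proof -
      have "\<psi> (k * v) \<le> C * real (k * v) powr (- \<epsilon>)"
        using that a(5) by (intro \<psi>(2)) (simp add: Suc_le_eq)
      also have "real (k * v) powr (- \<epsilon>) \<le> real v powr (- \<epsilon>)"
        using that a(5) \<open>\<epsilon> > 0\<close> by (intro powr_mono2') auto
      finally show ?thesis
        using \<psi>(1) by simp
    qed
    have "c0 / (2 * real a) ^ \<eta> \<le> c0 / real_of_int \<bar>int a - b\<bar> ^ \<eta>"
    proof (intro divide_left_mono power_mono mult_pos_pos)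
      \<comment> \<open>\<open>b\<close> may be negative, hence the factor 2, which ends up in
        \<open>B\<close>.\<close>
      have "\<bar>int a - b\<bar> \<le> 2 * int a"
        using a(2) by linarith
      then show "real_of_int \<bar>int a - b\<bar> \<le> 2 * real a"
        by (metis of_int_le_iff of_int_mult of_int_numeral of_int_of_nat_eq)
    qed (use a c0 in auto)
    also have "\<dots> \<le> \<bar>of_int (int a - b) * \<gamma> - of_int p\<bar>"
      by (rule bound) (use a in auto)
    also have "\<dots> \<le> real_of_int \<bar>b\<bar> * \<psi> (a * v) + real a * \<psi> (nat \<bar>b\<bar> * v)"
      by (rule close)
    also have "\<dots> \<le> real a * (C * real v powr (- \<epsilon>)) + real a * (C * real v powr (- \<epsilon>))"
    proof (intro add_mono)
      have "real_of_int \<bar>b\<bar> * \<psi> (a * v) \<le> real_of_int \<bar>b\<bar> * (C * real v powr (- \<epsilon>))"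
        using \<psi>v[OF a(1)] by (intro mult_left_mono) auto
      also have "\<dots> \<le> real a * (C * real v powr (- \<epsilon>))"
      proof (intro mult_right_mono)
        have "real_of_int \<bar>b\<bar> \<le> real_of_int (int a)"
          using a(2) by (simp only: of_int_le_iff)
        then show "real_of_int \<bar>b\<bar> \<le> real a"
          by simp
      qed (use \<psi>(1) in auto)
      finally show "real_of_int \<bar>b\<bar> * \<psi> (a * v) \<le> real a * (C * real v powr (- \<epsilon>))" .
      show "real a * \<psi> (nat \<bar>b\<bar> * v) \<le> real a * (C * real v powr (- \<epsilon>))"
        using \<psi>v[of "nat \<bar>b\<bar>"] a(4) by (intro mult_left_mono) auto
    qed
    finally have "c0 / (2 * real a) ^ \<eta> \<le> 2 * C * real a / real v powr \<epsilon>"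
      by (simp add: powr_minus_divide)
    then have "c0 * real v powr \<epsilon> \<le> 2 * C * real a * (2 * real a) ^ \<eta>"
      using a(1,5) by (simp add: divide_le_eq pos_le_divide_eq mult_ac)
    then have "real v powr \<epsilon> \<le> B * real a powr (real \<eta> + 1)"
      unfolding B_def using c0 a(1)
      by (simp add: powr_add powr_realpow power_mult_distrib field_simps)
    then have "real a powr \<epsilon> * real v powr \<epsilon> \<le> real a powr \<epsilon> * (B * real a powr (real \<eta> + 1))"
      by (intro mult_left_mono) auto
    then have "real (a * v) powr \<epsilon> \<le> B * real a powr \<theta>"
      unfolding \<theta>_def by (simp add: powr_mult powr_add mult_ac)
    then have "(1 / B) * real (a * v) powr \<epsilon> \<le> real a powr \<theta>"
      using \<open>B > 0\<close> by (simp add: field_simps)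
    then have "((1 / B) * real (a * v) powr \<epsilon>) powr (1 / \<theta>) \<le> (real a powr \<theta>) powr (1 / \<theta>)"
      using \<theta> \<open>B > 0\<close> by (intro powr_mono2) auto
    then show ?thesis
      using \<theta> \<open>B > 0\<close> by (subst (asm) powr_mult) (auto simp: powr_powr)
  qed
  then have "overlaps_need_large_multiplier \<gamma> \<psi> ((1 / B) powr (1 / \<theta>)) (\<epsilon> / \<theta>)"
    unfolding overlaps_need_large_multiplier_def by blast
  moreover have "(1 / B) powr (1 / \<theta>) > 0" "\<epsilon> / \<theta> > 0"
    using \<open>B > 0\<close> \<theta> \<open>\<epsilon> > 0\<close> by auto
  ultimately show ?thesis
    using that by blast
qed

section \<open>Shells of lattice vectors and their common divisors\<close>

definition shell :: "nat \<Rightarrow> (int \<times> int) set" where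
  "shell n = {q. sup_norm q = n}"

lemma card_shell:
  assumes "n \<ge> 1"
  shows "finite (shell n)" "card (shell n) = 8 * n"
proof -
  define B where "B k = {- k..k} \<times> {- k..k}" for k :: int
  have eq: "shell n = B (int n) - B (int n - 1)"
    using assms unfolding shell_def B_def sup_norm_def by (auto simp: max_def)
  show "finite (shell n)"
    unfolding eq B_def by simp
  have card_B: "card (B k) = nat (2 * k + 1) * nat (2 * k + 1)" for k
    unfolding B_def by (simp add: card_cartesian_product)
  have side: "nat (2 * int n + 1) = 2 * n + 1" "nat (2 * (int n - 1) + 1) = 2 * n - 1"
    using assms by (cases n; auto)+
  have "card (shell n) = card (B (int n)) - card (B (int n - 1))"
    unfolding eq by (rule card_Diff_subset) (auto simp: B_def)
  also have "\<dots> = (2 * n + 1) * (2 * n + 1) - (2 * n - 1) * (2 * n - 1)"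
    unfolding card_B side ..
  also have "(2 * n + 1) * (2 * n + 1) - (2 * n - 1) * (2 * n - 1) = 8 * n"
  proof -
    obtain k where "n = Suc k"
      using assms by (cases n) auto
    then show ?thesis
      by (simp add: algebra_simps)
  qed
  finally show "card (shell n) = 8 * n" .
qed

lemma sup_norm_eq_0: "sup_norm q = 0 \<longleftrightarrow> q = (0, 0)"
  by (cases q) (auto simp: sup_norm_def)

lemma sup_norm_multiple: "sup_norm (k * fst v, k * snd v) = nat \<bar>k\<bar> * sup_norm v"
proof -
  have "max (\<bar>k\<bar> * x) (\<bar>k\<bar> * y) = \<bar>k\<bar> * max x y" for x y
    by (simp add: max_mult_distrib_left)
  then show ?thesis
    unfolding sup_norm_def by (simp add: abs_mult nat_mult_distrib)
qed

text \<open>The coprime ratio of the first coordinates is also that of the second ones: by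
  proportionality and coprimality the multiplier of \<open>fst q\<close> divides
  \<open>snd q\<close>. The vector \<open>v\<close> need not be primitive; what matters is that the
  two multipliers are coprime.\<close>

lemma parallel_decomposition:
  assumes "q \<noteq> (0, 0)" "q' \<noteq> (0, 0)" and par: "fst q * snd q' = snd q * fst q'"
  obtains a :: nat and b :: int and v where "a > 0" "coprime (int a) b" "b \<noteq> 0" "v \<noteq> (0, 0)"
    "q = (int a * fst v, int a * snd v)" "q' = (b * fst v, b * snd v)"
proof -
  have main: "\<exists>a b v. (a::nat) > 0 \<and> coprime (int a) b \<and> q = (int a * fst v, int a * snd v) \<and> q' = (b * fst v, b * snd v)"
    if "fst q \<noteq> 0" "fst q * snd q' = snd q * fst q'" for q q' :: "int \<times> int"
  proof -
    obtain x y x' y' where q: "q = (x, y)" "q' = (x', y')"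
      by (meson surj_pair)
    have x: "x \<noteq> 0" "x * y' = y * x'"
      using that q by auto
    obtain t s where ts: "x = t * gcd x x'" "x' = s * gcd x x'" "coprime t s"
      using gcd_coprime_exists[of x x'] x(1) by auto
    have g: "gcd x x' \<noteq> 0"
      using x(1) by simp
    have "t \<noteq> 0"
      using ts(1) x(1) by auto
    have "gcd x x' * (t * y') = gcd x x' * (s * y)"
      using x(2) ts(1,2) by (metis mult.assoc mult.commute)
    then have ty: "t * y' = s * y"
      by (simp only: mult_left_cancel[OF g])
    then have "t dvd y"
      using ts(3) by (metis coprime_dvd_mult_right_iff dvd_triv_left)
    then obtain w where w: "y = t * w"
      by blast
    have "y' = s * w"
      using ty w \<open>t \<noteq> 0\<close> by simp
    \<comment> \<open>The sign of \<open>t\<close> is moved into both \<open>b\<close> and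
      \<open>v\<close>, so that the multiplier \<open>a\<close> becomes positive.\<close>
    define \<sigma> where "\<sigma> = sgn t"
    have \<sigma>: "int (nat \<bar>t\<bar>) * (\<sigma> * z) = t * z" "\<sigma> * s * (\<sigma> * z) = s * z" for z
      unfolding \<sigma>_def using \<open>t \<noteq> 0\<close> by (auto simp: sgn_if)
    have "coprime (int (nat \<bar>t\<bar>)) (\<sigma> * s)"
      using ts(3) \<open>t \<noteq> 0\<close> unfolding \<sigma>_def by (auto simp: sgn_if)
    moreover have "q = (int (nat \<bar>t\<bar>) * (\<sigma> * gcd x x'), int (nat \<bar>t\<bar>) * (\<sigma> * w))"
      unfolding \<sigma> q(1) w using ts(1)[symmetric] by simp
    moreover have "q' = (\<sigma> * s * (\<sigma> * gcd x x'), \<sigma> * s * (\<sigma> * w))"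
      unfolding \<sigma> q(2) \<open>y' = s * w\<close> using ts(2)[symmetric] by simp
    moreover have "nat \<bar>t\<bar> > 0"
      using \<open>t \<noteq> 0\<close> by simp
    ultimately show ?thesis
      by (intro exI[of _ "nat \<bar>t\<bar>"] exI[of _ "\<sigma> * s"] exI[of _ "(\<sigma> * gcd x x', \<sigma> * w)"]) simp
  qed
  have "\<exists>a b v. (a::nat) > 0 \<and> coprime (int a) b \<and> q = (int a * fst v, int a * snd v) \<and> q' = (b * fst v, b * snd v)"
  proof (cases "fst q = 0")
    case False
    then show ?thesis
      using main par by blast
  next
    case True
    then have "snd q \<noteq> 0"
      using assms(1) by (metis prod.collapse)
    then obtain a b v where "(a::nat) > 0" "coprime (int a) b"
      "prod.swap q = (int a * fst v, int a * snd v)" "prod.swap q' = (b * fst v, b * snd v)"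
      using main[of "prod.swap q" "prod.swap q'"] par by auto
    then show ?thesis
      by (intro exI[of _ a] exI[of _ b] exI[of _ "prod.swap v"]) (auto simp: prod_eq_iff)
  qed
  then obtain a b v where abv: "(a::nat) > 0" "coprime (int a) b"
    "q = (int a * fst v, int a * snd v)" "q' = (b * fst v, b * snd v)"
    by blast
  moreover have "b \<noteq> 0" "v \<noteq> (0, 0)"
    using abv assms(1,2) by auto
  ultimately show ?thesis
    using that by blast
qed

text \<open>Division by \<open>a\<close> carries these vectors to the shell of norm
  \<open>n / a\<close>.\<close>

lemma card_shell_multiples_le:
  assumes "n \<ge> 1" "a > 0"
  shows "real (card {q \<in> shell n. int a dvd fst q \<and> int a dvd snd q}) \<le> (if a dvd n then 8 * real n / real a else 0)"
proof -
  let ?S = "{q \<in> shell n. int a dvd fst q \<and> int a dvd snd q}"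
  have mult: "\<exists>v. q = (int a * fst v, int a * snd v) \<and> n = a * sup_norm v" if q: "q \<in> ?S" for q
  proof -
    obtain x y where "fst q = int a * x" "snd q = int a * y"
      using q by (auto simp: dvd_def)
    then have "q = (int a * fst (x, y), int a * snd (x, y))"
      by (simp add: prod_eq_iff)
    moreover from this have "n = a * sup_norm (x, y)"
      using that sup_norm_multiple[of "int a" "(x, y)"] by (simp add: shell_def)
    ultimately show ?thesis
      by blast
  qed
  show ?thesis
  proof (cases "a dvd n")
    case False
    then have empty: "?S = {}"
      using mult by fastforce
    show ?thesis
      unfolding empty using False by simp
  next
    case True
    then obtain m where m: "n = a * m"
      by blast
    then have "m \<ge> 1"
      using assms by (cases m) auto
    have "?S \<subseteq> (\<lambda>v. (int a * fst v, int a * snd v)) ` shell m"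
    proof
      fix q assume "q \<in> ?S"
      then obtain v where v: "q = (int a * fst v, int a * snd v)" "n = a * sup_norm v"
        using mult by blast
      then have "v \<in> shell m"
        using m assms(2) by (simp add: shell_def)
      then show "q \<in> (\<lambda>v. (int a * fst v, int a * snd v)) ` shell m"
        using v(1) by blast
    qed
    then have "card ?S \<le> card (shell m)"
      using card_shell(1)[OF \<open>m \<ge> 1\<close>] by (meson card_image_le card_mono finite_imageI order.trans)
    then have "real (card ?S) \<le> 8 * real m"
      using card_shell(2)[OF \<open>m \<ge> 1\<close>] by simp
    then show ?thesis
      using True m assms(2) by simp
  qed
qed

text \<open>Under \<open>overlaps_need_large_multiplier\<close> these are the only multipliers
  \<open>a\<close> through which \<open>q\<close> can be positively correlated with a different
  vector of at most the same norm.\<close>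

definition large_common_divisors :: "real \<Rightarrow> real \<Rightarrow> int \<times> int \<Rightarrow> nat set" where
  "large_common_divisors c \<kappa> q =
     {a. a > 0 \<and> int a dvd fst q \<and> int a dvd snd q \<and> c * real (sup_norm q) powr \<kappa> \<le> real a}"

lemma common_divisor_le_sup_norm:
  assumes "q \<noteq> (0, 0)" "int a dvd fst q" "int a dvd snd q"
  shows "a dvd sup_norm q" "a \<le> sup_norm q"
proof -
  obtain x y where "fst q = int a * x" "snd q = int a * y"
    using assms by (auto simp: dvd_def)
  then have "q = (int a * fst (x, y), int a * snd (x, y))"
    by (simp add: prod_eq_iff)
  then have "sup_norm q = a * sup_norm (x, y)"
    using sup_norm_multiple[of "int a" "(x, y)"] by simp
  then show "a dvd sup_norm q"
    by simp
  then show "a \<le> sup_norm q"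
    using assms(1) sup_norm_eq_0[of q] by (auto intro: dvd_imp_le)
qed

lemma finite_large_common_divisors: "q \<noteq> (0, 0) \<Longrightarrow> finite (large_common_divisors c \<kappa> q)"
  by (rule finite_subset[of _ "{..sup_norm q}"])
     (auto simp: large_common_divisors_def dest: common_divisor_le_sup_norm)

text \<open>Exchange the order of summation: a divisor \<open>a\<close> of \<open>n\<close> divides
  at most 8n/a vectors of the shell, and a \<ge> c n^\<kappa>. The divisor bound is taken with
  exponent \<kappa>, so that the powers of n cancel.\<close>

lemma sum_card_large_common_divisors_le:
  assumes "c > 0" "\<kappa> > 0"
  obtains K where "K > 0"
    "\<And>n. n \<ge> 1 \<Longrightarrow> (\<Sum>q\<in>shell n. real (card (large_common_divisors c \<kappa> q))) \<le> K * real n"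
proof -
  obtain C where C: "C > 0" "\<And>n::nat. n \<ge> 1 \<Longrightarrow> real (card {d. d dvd n}) \<le> C * real n powr \<kappa>"
    using card_divisors_le_powr[OF assms(2)] by metis
  have "(\<Sum>q\<in>shell n. real (card (large_common_divisors c \<kappa> q))) \<le> (8 * C / c) * real n" if "n \<ge> 1" for n
  proof -
    define D where "D = {a. a dvd n \<and> c * real n powr \<kappa> \<le> real a}"
    have finD: "finite {d. d dvd n}"
      using that by simp
    then have "finite D"
      unfolding D_def by simp
    have nz: "q \<noteq> (0, 0)" if "q \<in> shell n" for q
      using that \<open>n \<ge> 1\<close> sup_norm_eq_0[of q] by (auto simp: shell_def)
    have D_pos: "a > 0" if "a \<in> D" for a
      using that \<open>n \<ge> 1\<close> by (auto simp: D_def dvd_def intro!: gr0I)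
    have "(\<Sum>q\<in>shell n. real (card (large_common_divisors c \<kappa> q)))
        \<le> (\<Sum>q\<in>shell n. \<Sum>a\<in>D. if int a dvd fst q \<and> int a dvd snd q then 1 else 0)"
    proof (rule sum_mono)
      fix q assume q: "q \<in> shell n"
      have "large_common_divisors c \<kappa> q \<subseteq> {a \<in> D. int a dvd fst q \<and> int a dvd snd q}"
        using q common_divisor_le_sup_norm(1)[OF nz[OF q]]
        by (auto simp: large_common_divisors_def D_def shell_def)
      then have "card (large_common_divisors c \<kappa> q) \<le> card {a \<in> D. int a dvd fst q \<and> int a dvd snd q}"
        using \<open>finite D\<close> by (intro card_mono) auto
      also have "\<dots> = (\<Sum>a\<in>D. if int a dvd fst q \<and> int a dvd snd q then 1 else 0)"
        using \<open>finite D\<close> by (simp add: sum.If_cases Int_def)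
      finally have "real (card (large_common_divisors c \<kappa> q))
          \<le> real (\<Sum>a\<in>D. if int a dvd fst q \<and> int a dvd snd q then 1 else 0)"
        by (rule of_nat_mono)
      also have "\<dots> = (\<Sum>a\<in>D. if int a dvd fst q \<and> int a dvd snd q then 1 else 0)"
        unfolding of_nat_sum by (intro sum.cong) auto
      finally show "real (card (large_common_divisors c \<kappa> q))
          \<le> (\<Sum>a\<in>D. if int a dvd fst q \<and> int a dvd snd q then 1 else 0)" .
    qed
    also have "\<dots> = (\<Sum>a\<in>D. real (card {q \<in> shell n. int a dvd fst q \<and> int a dvd snd q}))"
      using card_shell(1)[OF that]
      by (subst sum.swap) (simp add: sum.If_cases Int_def)
    also have "\<dots> \<le> (\<Sum>a\<in>D. 8 * real n / (c * real n powr \<kappa>))"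
    proof (rule sum_mono)
      fix a assume a: "a \<in> D"
      have "real (card {q \<in> shell n. int a dvd fst q \<and> int a dvd snd q}) \<le> 8 * real n / real a"
        using card_shell_multiples_le[OF that D_pos[OF a]] a by (simp add: D_def)
      also have "\<dots> \<le> 8 * real n / (c * real n powr \<kappa>)"
        using a D_pos[OF a] \<open>c > 0\<close> that by (intro divide_left_mono) (auto simp: D_def)
      finally show "real (card {q \<in> shell n. int a dvd fst q \<and> int a dvd snd q}) \<le> 8 * real n / (c * real n powr \<kappa>)" .
    qed
    also have "\<dots> = real (card D) * (8 * real n / (c * real n powr \<kappa>))"
      by simp
    also have "\<dots> \<le> (C * real n powr \<kappa>) * (8 * real n / (c * real n powr \<kappa>))"
    proof (intro mult_right_mono)
      have "real (card D) \<le> real (card {d. d dvd n})"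
        using finD by (intro of_nat_mono card_mono) (auto simp: D_def)
      then show "real (card D) \<le> C * real n powr \<kappa>"
        using C(2)[OF that] by linarith
    qed (use \<open>c > 0\<close> in auto)
    also have "\<dots> = (8 * C / c) * real n"
      using that \<open>c > 0\<close> by (simp add: field_simps)
    finally show ?thesis .
  qed
  moreover have "8 * C / c > 0"
    using C(1) \<open>c > 0\<close> by simp
  ultimately show ?thesis
    using that by blast
qed

section \<open>Variance of the counting function\<close>

definition hits_covariance :: "real \<Rightarrow> (nat \<Rightarrow> real) \<Rightarrow> int \<times> int \<Rightarrow> int \<times> int \<Rightarrow> real" where
  "hits_covariance \<gamma> \<psi> q q' =
     (\<integral>z. hits \<gamma> (\<psi> (sup_norm q)) q z * hits \<gamma> (\<psi> (sup_norm q')) q' z \<partial>torus_measure)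
       - 2 * \<psi> (sup_norm q) * (2 * \<psi> (sup_norm q'))"

lemma hits_covariance_commute: "hits_covariance \<gamma> \<psi> q q' = hits_covariance \<gamma> \<psi> q' q"
  unfolding hits_covariance_def by (simp add: mult.commute)

text \<open>With the longer vector \<open>q\<close> fixed, a positively correlated
  \<open>q' \<noteq> q\<close> is determined by a pair (a, b) with \<bar>b\<bar> \<le> a and
  \<open>a\<close> a large common divisor. At most 3a values of \<open>b\<close>, each contributing
  at most 2\<psi>/a, give 6\<psi> for each \<open>a\<close>; the summand 2 accounts for
  \<open>q' = q\<close>. Positive parts are summed so that negative covariances, which cannot hurt,
  need no discussion.\<close>

lemma sum_hits_covariance_le:
  fixes \<gamma> c \<kappa> :: real and \<psi> :: "nat \<Rightarrow> real"
  assumes \<psi>: "\<And>n. n \<ge> 1 \<Longrightarrow> \<psi> n \<in> {0..1/2}"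
    and large: "overlaps_need_large_multiplier \<gamma> \<psi> c \<kappa>"
    and q: "q \<noteq> (0, 0)" and n: "n = sup_norm q"
    and T: "finite T" "\<And>q'. q' \<in> T \<Longrightarrow> q' \<noteq> (0, 0) \<and> sup_norm q' \<le> n"
  shows "(\<Sum>q'\<in>T. max 0 (hits_covariance \<gamma> \<psi> q q')) \<le> \<psi> n * (2 + 6 * real (card (large_common_divisors c \<kappa> q)))"
proof -
  let ?L = "large_common_divisors c \<kappa> q"
  have pos_norm: "sup_norm q' \<ge> 1" if "q' \<noteq> (0, 0)" for q'
    using that sup_norm_eq_0[of q'] by linarith
  have \<psi>n: "0 \<le> \<psi> n" "\<psi> n \<le> 1/2"
    using \<psi>[of n] pos_norm[OF q] n by auto
  \<comment> \<open>The two equations expressing aq' = bq are recorded because they recover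
    \<open>q'\<close> from the pair, which makes the later choice function injective.\<close>
  have bound: "\<exists>a b. a > 0 \<and> \<bar>b\<bar> \<le> int a \<and> int a * fst q' = b * fst q \<and> int a * snd q' = b * snd q \<and>
      hits_covariance \<gamma> \<psi> q q' \<le> 2 * \<psi> n / real a \<and> (q' = q \<or> a \<in> ?L)"
    if q': "q' \<noteq> (0, 0)" "sup_norm q' \<le> n" and cov: "hits_covariance \<gamma> \<psi> q q' > 0" for q'
  proof -
    define n' where "n' = sup_norm q'"
    have \<psi>n': "0 \<le> \<psi> n'" "\<psi> n' \<le> 1/2"
      using \<psi>[of n'] pos_norm[OF q'(1)] n'_def by auto
    have "fst q * snd q' = snd q * fst q'"
      using integral_hits_mult_independent[OF \<psi>n \<psi>n', of q q' \<gamma>] cov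
      unfolding hits_covariance_def n n'_def by fastforce
    then obtain a :: nat and b :: int and v where abv: "a > 0" "coprime (int a) b" "b \<noteq> 0" "v \<noteq> (0, 0)"
      "q = (int a * fst v, int a * snd v)" "q' = (b * fst v, b * snd v)"
      using parallel_decomposition[OF q q'(1)] by metis
    have na: "n = a * sup_norm v" "n' = nat \<bar>b\<bar> * sup_norm v"
      using sup_norm_multiple[of "int a" v] sup_norm_multiple[of b v] abv(5,6) n n'_def by auto
    have v_pos: "sup_norm v > 0"
      using sup_norm_eq_0[of v] abv(4) by auto
    have "nat \<bar>b\<bar> \<le> a"
      using q'(2) na v_pos unfolding n'_def[symmetric] by simp
    then have ba: "\<bar>b\<bar> \<le> int a"
      by linarith
    have "(\<integral>z. hits \<gamma> (\<psi> n) q z * hits \<gamma> (\<psi> n') q' z \<partial>torus_measure) \<le> 4 * \<psi> n * \<psi> n' + 2 * \<psi> n / real a"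
      by (rule integral_hits_mult_parallel_le[OF \<psi>n \<psi>n'(1) abv(4,1,2,5,6)])
    then have "hits_covariance \<gamma> \<psi> q q' \<le> 2 * \<psi> n / real a"
      unfolding hits_covariance_def n n'_def by simp
    moreover have "q' = q \<or> a \<in> ?L"
    proof (cases "b = int a")
      case True
      then show ?thesis
        using abv(5,6) by simp
    next
      case False
      have "(\<integral>z. hits \<gamma> (\<psi> n) q z * hits \<gamma> (\<psi> n') q' z \<partial>torus_measure) \<noteq> 0"
      proof
        assume "(\<integral>z. hits \<gamma> (\<psi> n) q z * hits \<gamma> (\<psi> n') q' z \<partial>torus_measure) = 0"
        then have "hits_covariance \<gamma> \<psi> q q' = - 4 * (\<psi> n * \<psi> n')"
          unfolding hits_covariance_def n n'_def by simp
        then show False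
          using cov mult_nonneg_nonneg[OF \<psi>n(1) \<psi>n'(1)] by linarith
      qed
      then obtain p :: int where
        "\<bar>of_int (int a - b) * \<gamma> - of_int p\<bar> \<le> real_of_int \<bar>b\<bar> * \<psi> n + real a * \<psi> n'"
        using integral_hits_mult_parallel_eq_0[OF abv(5,6)] by (meson not_le)
      then have "c * real n powr \<kappa> \<le> real a"
        using large abv(1) ba False abv(3) v_pos na unfolding overlaps_need_large_multiplier_def by blast
      then show ?thesis
        using abv(1,5) n unfolding large_common_divisors_def by simp
    qed
    moreover have "int a * fst q' = b * fst q" "int a * snd q' = b * snd q"
      using abv(5,6) by simp_all
    ultimately show ?thesis
      using abv(1) ba by blast
  qed
  define T' where "T' = {q' \<in> T. q' \<noteq> q \<and> hits_covariance \<gamma> \<psi> q q' > 0}"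
  have "finite T'"
    unfolding T'_def using T(1) by simp
  have "\<forall>q'\<in>T'. \<exists>ab. \<bar>snd ab\<bar> \<le> int (fst ab) \<and> int (fst ab) * fst q' = snd ab * fst q \<and> int (fst ab) * snd q' = snd ab * snd q \<and>
      hits_covariance \<gamma> \<psi> q q' \<le> 2 * \<psi> n / real (fst ab) \<and> fst ab \<in> ?L"
  proof
    fix q' assume "q' \<in> T'"
    then have q': "q' \<noteq> (0, 0)" "sup_norm q' \<le> n" "q' \<noteq> q" "hits_covariance \<gamma> \<psi> q q' > 0"
      using T(2) unfolding T'_def by auto
    obtain a :: nat and b :: int where "\<bar>b\<bar> \<le> int a" "int a * fst q' = b * fst q" "int a * snd q' = b * snd q"
      "hits_covariance \<gamma> \<psi> q q' \<le> 2 * \<psi> n / real a" "a \<in> ?L"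
      using bound[OF q'(1,2,4)] q'(3) by blast
    then show "\<exists>ab. \<bar>snd ab\<bar> \<le> int (fst ab) \<and> int (fst ab) * fst q' = snd ab * fst q \<and> int (fst ab) * snd q' = snd ab * snd q \<and>
      hits_covariance \<gamma> \<psi> q q' \<le> 2 * \<psi> n / real (fst ab) \<and> fst ab \<in> ?L"
      by (intro exI[of _ "(a, b)"]) simp
  qed
  then obtain g where "\<forall>q'\<in>T'. \<bar>snd (g q')\<bar> \<le> int (fst (g q')) \<and> int (fst (g q')) * fst q' = snd (g q') * fst q \<and>
      int (fst (g q')) * snd q' = snd (g q') * snd q \<and>
      hits_covariance \<gamma> \<psi> q q' \<le> 2 * \<psi> n / real (fst (g q')) \<and> fst (g q') \<in> ?L"
    by (rule bchoice[THEN exE])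
  then have g: "\<And>q'. q' \<in> T' \<Longrightarrow> \<bar>snd (g q')\<bar> \<le> int (fst (g q'))"
    "\<And>q'. q' \<in> T' \<Longrightarrow> int (fst (g q')) * fst q' = snd (g q') * fst q"
    "\<And>q'. q' \<in> T' \<Longrightarrow> int (fst (g q')) * snd q' = snd (g q') * snd q"
    "\<And>q'. q' \<in> T' \<Longrightarrow> hits_covariance \<gamma> \<psi> q q' \<le> 2 * \<psi> n / real (fst (g q'))"
    "\<And>q'. q' \<in> T' \<Longrightarrow> fst (g q') \<in> ?L"
    by blast+
  have "inj_on g T'"
  proof (rule inj_onI)
    fix x y assume xy: "x \<in> T'" "y \<in> T'" "g x = g y"
    have "int (fst (g x)) \<noteq> 0"
      using g(5)[OF xy(1)] by (simp add: large_common_divisors_def)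
    moreover have "int (fst (g x)) * fst x = int (fst (g x)) * fst y" "int (fst (g x)) * snd x = int (fst (g x)) * snd y"
      using g(2,3)[OF xy(1)] g(2,3)[OF xy(2)] xy(3) by simp_all
    ultimately show "x = y"
      by (simp add: prod_eq_iff)
  qed
  have "(\<Sum>q'\<in>T. max 0 (hits_covariance \<gamma> \<psi> q q'))
      \<le> (\<Sum>q'\<in>T. (if q' = q then 2 * \<psi> n else 0) + (if q' \<in> T' then hits_covariance \<gamma> \<psi> q q' else 0))"
  proof (rule sum_mono)
    fix q' assume q': "q' \<in> T"
    have "hits_covariance \<gamma> \<psi> q q \<le> 2 * \<psi> n"
    proof (cases "hits_covariance \<gamma> \<psi> q q > 0")
      case True
      then obtain a :: nat where "a > 0" "hits_covariance \<gamma> \<psi> q q \<le> 2 * \<psi> n / real a"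
        using bound[OF q _ True] n by auto
      moreover have "2 * \<psi> n / real a \<le> 2 * \<psi> n / 1"
        using \<open>a > 0\<close> \<psi>n(1) by (intro divide_left_mono) auto
      ultimately show ?thesis
        by simp
    qed (use \<psi>n in auto)
    then show "max 0 (hits_covariance \<gamma> \<psi> q q')
      \<le> (if q' = q then 2 * \<psi> n else 0) + (if q' \<in> T' then hits_covariance \<gamma> \<psi> q q' else 0)"
      using q' \<psi>n(1) unfolding T'_def by auto
  qed
  also have "\<dots> = (\<Sum>q'\<in>T. if q' = q then 2 * \<psi> n else 0) + (\<Sum>q'\<in>T'. hits_covariance \<gamma> \<psi> q q')"
  proof -
    have "T \<inter> T' = T'"
      unfolding T'_def by auto
    then show ?thesis
      using T(1) by (simp only: sum.distrib sum.inter_restrict[symmetric])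
  qed
  also have "\<dots> \<le> 2 * \<psi> n + 6 * \<psi> n * real (card ?L)"
  proof (rule add_mono)
    show "(\<Sum>q'\<in>T. if q' = q then 2 * \<psi> n else 0) \<le> 2 * \<psi> n"
      using T(1) \<psi>n by (simp add: sum.delta)
    have fin: "finite ?L"
      by (rule finite_large_common_divisors[OF q])
    have "(\<Sum>q'\<in>T'. hits_covariance \<gamma> \<psi> q q') \<le> (\<Sum>q'\<in>T'. 2 * \<psi> n / real (fst (g q')))"
      by (intro sum_mono g)
    also have "\<dots> = (\<Sum>ab\<in>g ` T'. 2 * \<psi> n / real (fst ab))"
      by (simp add: sum.reindex[OF \<open>inj_on g T'\<close>])
    \<comment> \<open>The image of \<open>g\<close> is enlarged to all pairs; extra terms, such as b
      = 0 or pairs that are not coprime, are nonnegative.\<close>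
    also have "\<dots> \<le> (\<Sum>ab\<in>Sigma ?L (\<lambda>a. {- int a..int a}). 2 * \<psi> n / real (fst ab))"
    proof (rule sum_mono2)
      show "g ` T' \<subseteq> Sigma ?L (\<lambda>a. {- int a..int a})"
      proof (rule image_subsetI)
        fix x assume "x \<in> T'"
        then show "g x \<in> Sigma ?L (\<lambda>a. {- int a..int a})"
          using g(1)[of x] g(5)[of x] by (cases "g x") (auto simp: abs_le_iff)
      qed
    qed (use fin \<psi>n in auto)
    also have "\<dots> = (\<Sum>a\<in>?L. \<Sum>b\<in>{- int a..int a}. 2 * \<psi> n / real a)"
      using fin by (subst sum.Sigma) (auto simp: split_beta)
    also have "\<dots> \<le> (\<Sum>a\<in>?L. 6 * \<psi> n)"
    proof (rule sum_mono)
      fix a assume "a \<in> ?L"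
      then have "a \<ge> 1"
        by (simp add: large_common_divisors_def)
      have "(\<Sum>b\<in>{- int a..int a}. 2 * \<psi> n / real a) = (2 * real a + 1) * (2 * \<psi> n / real a)"
        by simp
      also have "\<dots> \<le> (3 * real a) * (2 * \<psi> n / real a)"
        using \<open>a \<ge> 1\<close> \<psi>n by (intro mult_right_mono) auto
      also have "\<dots> = 6 * \<psi> n"
        using \<open>a \<ge> 1\<close> by simp
      finally show "(\<Sum>b\<in>{- int a..int a}. 2 * \<psi> n / real a) \<le> 6 * \<psi> n" .
    qed
    finally show "(\<Sum>q'\<in>T'. hits_covariance \<gamma> \<psi> q q') \<le> 6 * \<psi> n * real (card ?L)"
      by (simp add: mult.commute)
  qed
  finally show ?thesis
    by (simp add: algebra_simps)
qed

section \<open>Second moments over annuli\<close>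

definition annulus :: "nat \<Rightarrow> nat \<Rightarrow> (int \<times> int) set" where
  "annulus m n = (\<Union>k\<in>{m<..n}. shell k)"

lemma finite_annulus: "finite (annulus m n)"
  unfolding annulus_def using card_shell(1) by auto

lemma annulus_iff: "q \<in> annulus m n \<longleftrightarrow> m < sup_norm q \<and> sup_norm q \<le> n"
  unfolding annulus_def shell_def by auto

lemma annulus_nonzero: "q \<in> annulus m n \<Longrightarrow> q \<noteq> (0, 0)"
  using sup_norm_eq_0[of q] by (auto simp: annulus_iff)

lemma sum_annulus: "(\<Sum>q\<in>annulus m n. f q) = (\<Sum>k\<in>{m<..n}. \<Sum>q\<in>shell k. f q)"
  unfolding annulus_def using card_shell(1) by (subst sum.UNION_disjoint) (auto simp: shell_def)

text \<open>Each ordered pair is charged to its longer vector. By symmetry both cases give the same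
  sum \<open>S\<close>, and counting pairs of equal norm twice is harmless for positive parts. This
  doubles 16 + 6K, where 16 is twice the 8 from the size 8k of a shell and 6K comes from the large
  common divisors.\<close>

lemma sum_double_hits_covariance_le:
  fixes \<gamma> c \<kappa> :: real and \<psi> :: "nat \<Rightarrow> real"
  assumes \<psi>: "\<And>n. n \<ge> 1 \<Longrightarrow> \<psi> n \<in> {0..1/2}"
    and large: "overlaps_need_large_multiplier \<gamma> \<psi> c \<kappa>"
    and K: "\<And>n. n \<ge> 1 \<Longrightarrow> (\<Sum>q\<in>shell n. real (card (large_common_divisors c \<kappa> q))) \<le> K * real n"
  shows "(\<Sum>q\<in>annulus m n. \<Sum>q'\<in>annulus m n. hits_covariance \<gamma> \<psi> q q')
    \<le> (32 + 12 * K) * (\<Sum>k\<in>{m<..n}. real k * \<psi> k)"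
proof -
  let ?A = "annulus m n" and ?cov = "\<lambda>q q'. max 0 (hits_covariance \<gamma> \<psi> q q')"
  define S where "S = (\<Sum>q\<in>?A. \<Sum>q'\<in>{q' \<in> ?A. sup_norm q' \<le> sup_norm q}. ?cov q q')"
  have S_eq: "S = (\<Sum>q\<in>?A. \<Sum>q'\<in>?A. if sup_norm q' \<le> sup_norm q then ?cov q q' else 0)"
    unfolding S_def by (intro sum.cong refl sum.inter_filter finite_annulus)
  have "(\<Sum>q\<in>?A. \<Sum>q'\<in>?A. hits_covariance \<gamma> \<psi> q q')
    \<le> (\<Sum>q\<in>?A. \<Sum>q'\<in>?A. (if sup_norm q' \<le> sup_norm q then ?cov q q' else 0)
        + (if sup_norm q \<le> sup_norm q' then ?cov q' q else 0))"
    by (intro sum_mono) (auto simp: hits_covariance_commute[of \<gamma> \<psi>])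
  also have "\<dots> = S + (\<Sum>q\<in>?A. \<Sum>q'\<in>?A. if sup_norm q \<le> sup_norm q' then ?cov q' q else 0)"
    unfolding S_eq by (simp add: sum.distrib)
  also have "(\<Sum>q\<in>?A. \<Sum>q'\<in>?A. if sup_norm q \<le> sup_norm q' then ?cov q' q else 0) = S"
    unfolding S_eq by (rule sum.swap)
  also have "S \<le> (\<Sum>q\<in>?A. \<psi> (sup_norm q) * (2 + 6 * real (card (large_common_divisors c \<kappa> q))))"
    unfolding S_def
  proof (rule sum_mono)
    fix q assume "q \<in> ?A"
    then have "q \<noteq> (0, 0)"
      by (rule annulus_nonzero)
    then show "(\<Sum>q'\<in>{q' \<in> ?A. sup_norm q' \<le> sup_norm q}. ?cov q q')
        \<le> \<psi> (sup_norm q) * (2 + 6 * real (card (large_common_divisors c \<kappa> q)))"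
      by (intro sum_hits_covariance_le[OF _ large _ refl])
         (use \<psi> in blast, assumption, use finite_annulus in simp, use annulus_nonzero in blast)
  qed
  also have "\<dots> = (\<Sum>k\<in>{m<..n}. \<psi> k * (2 * real (card (shell k)) + 6 * (\<Sum>q\<in>shell k. real (card (large_common_divisors c \<kappa> q)))))"
    unfolding sum_annulus
    by (intro sum.cong refl) (simp add: shell_def sum.distrib sum_distrib_left algebra_simps)
  also have "\<dots> \<le> (\<Sum>k\<in>{m<..n}. \<psi> k * (2 * (8 * real k) + 6 * (K * real k)))"
  proof (rule sum_mono)
    fix k assume "k \<in> {m<..n}"
    then have "k \<ge> 1"
      by simp
    then show "\<psi> k * (2 * real (card (shell k)) + 6 * (\<Sum>q\<in>shell k. real (card (large_common_divisors c \<kappa> q))))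
      \<le> \<psi> k * (2 * (8 * real k) + 6 * (K * real k))"
      using \<psi>[of k] K[of k] card_shell(2)[of k] by (intro mult_left_mono add_mono) auto
  qed
  also have "\<dots> = (16 + 6 * K) * (\<Sum>k\<in>{m<..n}. real k * \<psi> k)"
    unfolding sum_distrib_left by (intro sum.cong) (auto simp: algebra_simps)
  finally show ?thesis
    by (simp add: algebra_simps)
qed

text \<open>The annulus starts above norm 0 and so encodes \<open>q \<noteq> (0, 0)\<close>;
  \<open>prod.swap\<close> reconciles the order (p, q) with a sum over \<open>q\<close>.\<close>

lemma approx_count_eq:
  "real (approx_count \<psi> z Q \<gamma>) = (\<Sum>q\<in>annulus 0 Q. hits \<gamma> (\<psi> (sup_norm q)) q z)"
proof -
  define P where "P q = {p::int. \<bar>(of_int (fst q) * fst z + of_int (snd q) * snd z - \<gamma>) - of_int p\<bar> \<le> \<psi> (sup_norm q)}" for q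
  have "approx_solutions \<psi> z Q \<gamma> = prod.swap ` Sigma (annulus 0 Q) P"
  proof (intro set_eqI iffI)
    fix x assume "x \<in> approx_solutions \<psi> z Q \<gamma>"
    then have "prod.swap x \<in> Sigma (annulus 0 Q) P"
      using sup_norm_eq_0[of "snd x"] unfolding approx_solutions_def P_def
      by (auto simp: annulus_iff algebra_simps)
    then show "x \<in> prod.swap ` Sigma (annulus 0 Q) P"
      by (metis image_eqI swap_swap)
  next
    fix x assume "x \<in> prod.swap ` Sigma (annulus 0 Q) P"
    then show "x \<in> approx_solutions \<psi> z Q \<gamma>"
      using annulus_nonzero[of "snd x" 0 Q] unfolding approx_solutions_def P_def
      by (auto simp: annulus_iff algebra_simps)
  qed
  then have "approx_count \<psi> z Q \<gamma> = card (Sigma (annulus 0 Q) P)"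
    unfolding approx_count_def by (simp add: card_image)
  also have "\<dots> = (\<Sum>q\<in>annulus 0 Q. card (P q))"
    using finite_annulus by (intro card_SigmaI) (auto simp: P_def near_integers_eq)
  finally show ?thesis
    unfolding hits_def near_count_def P_def by simp
qed

text \<open>A shell has 8k vectors, each with mean 2\<psi>(k): this is the factor 16 of the first
  sum in \<open>main_term\<close>.\<close>

lemma sum_annulus_mean:
  "(\<Sum>q\<in>annulus m n. 2 * \<psi> (sup_norm q)) = 16 * (\<Sum>k\<in>{m<..n}. real k * \<psi> k)"
proof -
  have "(\<Sum>q\<in>shell k. 2 * \<psi> (sup_norm q)) = 16 * (real k * \<psi> k)" if "k \<in> {m<..n}" for k
    using that card_shell(2)[of k] by (simp add: shell_def)
  then show ?thesis
    unfolding sum_annulus by (simp add: sum_distrib_left)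
qed

lemma variance_approx_count:
  fixes \<gamma> c \<kappa> :: real and \<psi> :: "nat \<Rightarrow> real"
  assumes \<psi>: "\<And>n. n \<ge> 1 \<Longrightarrow> \<psi> n \<in> {0..1/2}"
    and cov: "(\<Sum>q\<in>annulus m n. \<Sum>q'\<in>annulus m n. hits_covariance \<gamma> \<psi> q q') \<le> B"
    and "m \<le> n"
  shows "(\<integral>\<^sup>+z. ennreal ((real (approx_count \<psi> z n \<gamma>) - real (approx_count \<psi> z m \<gamma>)
      - 16 * (\<Sum>k\<in>{m<..n}. real k * \<psi> k))\<^sup>2) \<partial>torus_measure) \<le> ennreal B"
proof -
  let ?X = "\<lambda>q. hits \<gamma> (\<psi> (sup_norm q)) q" and ?A = "annulus m n"
  have \<psi>A: "0 \<le> \<psi> (sup_norm q)" "\<psi> (sup_norm q) \<le> 1/2" if "q \<in> ?A" for q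
    using \<psi>[of "sup_norm q"] that by (auto simp: annulus_iff)
  have split: "annulus 0 n = annulus 0 m \<union> ?A" "annulus 0 m \<inter> ?A = {}"
    using \<open>m \<le> n\<close> by (auto simp: annulus_iff)
  have diff: "real (approx_count \<psi> z n \<gamma>) - real (approx_count \<psi> z m \<gamma>) - 16 * (\<Sum>k\<in>{m<..n}. real k * \<psi> k)
      = (\<Sum>q\<in>?A. ?X q z - 2 * \<psi> (sup_norm q))" for z
    unfolding approx_count_eq split(1)
    by (subst sum.union_disjoint) (auto simp: finite_annulus split(2) sum_annulus_mean sum_subtractf)
  have unit: "measure torus_measure (space torus_measure) = 1"
    by (simp add: prob_space_torus_measure measure_def)
  note moment = torus.second_moment_centred_sum[OF finite_annulus unit, of m n ?X "\<lambda>q. 2 * \<psi> (sup_norm q)"]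
  have int: "integrable torus_measure (\<lambda>z. (\<Sum>q\<in>?A. ?X q z - 2 * \<psi> (sup_norm q))\<^sup>2)"
    using \<psi>A annulus_nonzero by (intro moment(1) integrable_hits integrable_hits_mult integral_hits) auto
  have eq: "(\<integral>z. (\<Sum>q\<in>?A. ?X q z - 2 * \<psi> (sup_norm q))\<^sup>2 \<partial>torus_measure)
      = (\<Sum>q\<in>?A. \<Sum>q'\<in>?A. hits_covariance \<gamma> \<psi> q q')"
    unfolding hits_covariance_def
    using \<psi>A annulus_nonzero by (intro moment(2) integrable_hits integrable_hits_mult integral_hits) auto
  have "(\<integral>\<^sup>+z. ennreal ((\<Sum>q\<in>?A. ?X q z - 2 * \<psi> (sup_norm q))\<^sup>2) \<partial>torus_measure)
      = ennreal (\<integral>z. (\<Sum>q\<in>?A. ?X q z - 2 * \<psi> (sup_norm q))\<^sup>2 \<partial>torus_measure)"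
    using int by (intro nn_integral_eq_integral) auto
  then show ?thesis
    unfolding diff eq using cov by (simp add: ennreal_leI)
qed

text \<open>Cut at M, the square root of X rounded up: up to M each term is at most 1/2, beyond it
  \<psi>(q) \<le> q \<psi>(q) / M. The total M/2 + X/M is at most 2 sqrt X because sqrt X \<ge>
  1.\<close>

lemma sum_le_sqrt_weighted_sum:
  fixes \<psi> :: "nat \<Rightarrow> real"
  assumes \<psi>: "\<And>n. n \<ge> 1 \<Longrightarrow> \<psi> n \<in> {0..1/2}" and "X \<ge> 1" and S: "(\<Sum>q=1..Q. real q * \<psi> q) \<le> X"
  shows "(\<Sum>q=1..Q. \<psi> q) \<le> 2 * sqrt X"
proof -
  define M where "M = nat \<lceil>sqrt X\<rceil>"
  have M: "sqrt X \<le> real M" "real M \<le> sqrt X + 1" "sqrt X \<ge> 1"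
    unfolding M_def using \<open>X \<ge> 1\<close> by (auto simp: real_nat_ceiling_ge)
  then have M_pos: "real M > 0"
    by linarith
  have "(\<Sum>q=1..Q. \<psi> q) \<le> (\<Sum>q=1..Q. (if q \<le> M then 1/2 else 0) + real q * \<psi> q / real M)"
  proof (rule sum_mono)
    fix q assume q: "q \<in> {1..Q}"
    then have \<psi>q: "0 \<le> \<psi> q" "\<psi> q \<le> 1/2"
      using \<psi>[of q] by auto
    show "\<psi> q \<le> (if q \<le> M then 1/2 else 0) + real q * \<psi> q / real M"
    proof (cases "q \<le> M")
      case True
      have "0 \<le> real q * \<psi> q / real M"
        using \<psi>q by simp
      then have "\<psi> q \<le> 1/2 + real q * \<psi> q / real M"
        using \<psi>q by linarith
      then show ?thesis
        using True by simp
    next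
      case False
      then have "\<psi> q * real M \<le> \<psi> q * real q"
        using \<psi>q by (intro mult_left_mono) auto
      then show ?thesis
        using False M_pos by (simp add: pos_le_divide_eq mult.commute)
    qed
  qed
  also have "\<dots> = real (card {q \<in> {1..Q}. q \<le> M}) / 2 + (\<Sum>q=1..Q. real q * \<psi> q) / real M"
    by (simp add: sum.distrib sum_divide_distrib sum.If_cases Int_def)
  also have "\<dots> \<le> real M / 2 + X / sqrt X"
  proof (rule add_mono)
    have "card {q \<in> {1..Q}. q \<le> M} \<le> card {1..M}"
      by (intro card_mono) auto
    then show "real (card {q \<in> {1..Q}. q \<le> M}) / 2 \<le> real M / 2"
      by simp
    show "(\<Sum>q=1..Q. real q * \<psi> q) / real M \<le> X / sqrt X"
      using M S \<open>X \<ge> 1\<close> by (intro frac_le) auto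
  qed
  also have "\<dots> \<le> 2 * sqrt X"
  proof -
    have "X / sqrt X = sqrt X"
      using \<open>X \<ge> 1\<close> by (simp add: real_div_sqrt)
    then show ?thesis
      using M by linarith
  qed
  finally show ?thesis .
qed

text \<open>Measurability and Fubini are handled with Borel sets; an almost everywhere statement
  survives completion, which gives it for Lebesgue measure.\<close>

lemma AE_lebesgue_on_unit_square:
  assumes "AE z in torus_measure. P z"
  shows "AE z in lebesgue_on ({0..<1} \<times> {0..<1}). P z"
proof -
  have "AE z in lborel. z \<in> {0..<1::real} \<times> {0..<1::real} \<longrightarrow> P z"
    using assms unit_square_sets unfolding torus_measure_def by (subst (asm) AE_restrict_space_iff) auto
  then have "AE z in lebesgue. z \<in> {0..<1::real} \<times> {0..<1::real} \<longrightarrow> P z"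
    by (rule AE_completion)
  then show ?thesis
    using unit_square_sets by (subst AE_restrict_space_iff) auto
qed

text \<open>The level \<open>r\<close> is the first with 2^r above X, so 2^r \<le> 2X and r + 1
  \<le> 4 ln X. It is chosen from the exact mean X, while the error is measured in the larger Y,
  which will include the second sum of \<open>main_term\<close>.\<close>

lemma dyadic_error_le:
  fixes X Y e :: real
  assumes "4 \<le> X" "X \<le> Y" "e \<ge> 0"
  obtains r :: nat where "X < 2 ^ r"
    "2 powr (real r / 2) * real (Suc r) powr e \<le> 2 * 4 powr e * (Y powr (1/2) * ln Y powr e)"
proof -
  obtain s :: nat where s: "2 ^ s \<le> nat \<lfloor>X\<rfloor>" "nat \<lfloor>X\<rfloor> < 2 ^ Suc s"
  proof -
    have "1 \<le> nat \<lfloor>X\<rfloor>"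
      using assms(1) by linarith
    then show ?thesis
      using ex_power_ivl1[of 2 "nat \<lfloor>X\<rfloor>"] that by auto
  qed
  define r where "r = Suc s"
  have "X < real (nat \<lfloor>X\<rfloor>) + 1" "real (nat \<lfloor>X\<rfloor>) \<le> X"
    using assms(1) by linarith+
  moreover have "real (nat \<lfloor>X\<rfloor>) + 1 \<le> 2 ^ r"
    using s(2) unfolding r_def by (metis Suc_eq_plus1 Suc_leI numeral_power_eq_of_nat_cancel_iff of_nat_1 of_nat_add of_nat_le_iff)
  moreover have "2 ^ r \<le> 2 * real (nat \<lfloor>X\<rfloor>)"
    using of_nat_mono[OF s(1), where 'a = real] unfolding r_def by simp
  ultimately have r: "X < 2 ^ r" "2 ^ r \<le> 2 * X"
    by linarith+
  \<comment> \<open>The bound 4 on X exceeds exp 1; ln X \<ge> 1 then absorbs the additive constants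
    in r + 1 \<le> 2 ln X + 2.\<close>
  have lnX: "ln X \<ge> 1"
  proof -
    have "exp 1 \<le> X"
      using assms(1) exp_le by linarith
    then show ?thesis
      using assms(1) by (simp add: ln_ge_iff)
  qed
  have "2 powr (real r / 2) = ((2::real) ^ r) powr (1/2)"
    by (simp add: powr_powr flip: powr_realpow)
  also have "\<dots> \<le> (4 * Y) powr (1/2)"
    using r assms by (intro powr_mono2) auto
  also have "\<dots> = 2 * Y powr (1/2)"
    using assms by (simp add: powr_mult powr_half_sqrt)
  finally have 1: "2 powr (real r / 2) \<le> 2 * Y powr (1/2)" .
  have "real r * ln 2 = ln ((2::real) ^ r)"
    by (simp add: ln_realpow)
  also have "\<dots> \<le> ln (2 * X)"
    using r assms by (intro ln_mono) auto
  also have "\<dots> = ln 2 + ln X"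
    using assms by (simp add: ln_mult)
  finally have "(real r - 1) * ln 2 \<le> ln X"
    by (simp add: algebra_simps)
  moreover have "(real r - 1) * (1/2) \<le> (real r - 1) * ln 2"
    using ln2_ge_two_thirds unfolding r_def by (intro mult_left_mono) auto
  ultimately have "real (Suc r) \<le> 4 * ln X"
    using lnX by simp
  also have "\<dots> \<le> 4 * ln Y"
    using assms by (simp add: ln_mono)
  finally have "real (Suc r) powr e \<le> (4 * ln Y) powr e"
    using assms by (intro powr_mono2) auto
  also have "\<dots> = 4 powr e * ln Y powr e"
    using assms by (simp add: powr_mult)
  finally have 2: "real (Suc r) powr e \<le> 4 powr e * ln Y powr e" .
  have "2 powr (real r / 2) * real (Suc r) powr e \<le> (2 * Y powr (1/2)) * (4 powr e * ln Y powr e)"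
    by (intro mult_mono 1 2) auto
  then show ?thesis
    using that r(1) by (simp add: mult_ac)
qed

theorem theorem2:
  fixes \<gamma> \<epsilon> \<delta> :: real and \<psi> :: "nat \<Rightarrow> real"
  assumes "\<gamma> \<notin> \<rat>"
    and "\<not> liouville_number \<gamma>"
    and "\<epsilon> > 0"
    and "\<And>q. q \<ge> 1 \<Longrightarrow> \<psi> q \<in> {0..1/2}"
    and "filterlim (\<lambda>Q. \<Sum>q=1..Q. real q * \<psi> q) at_top sequentially"
    and "\<psi> \<in> O(\<lambda>q. real q powr (- \<epsilon>))"
    and "\<delta> > 0"
  shows "AE \<alpha> in lebesgue_on ({0..<1} \<times> {0..<1}).
    (\<lambda>Q. real (approx_count \<psi> \<alpha> Q \<gamma>) - main_term \<psi> Q) \<in>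
      O(\<lambda>Q. main_term \<psi> Q powr (1/2) * ln (main_term \<psi> Q) powr (3/2 + \<delta>))"
proof -
  note \<psi> = assms(4)
  obtain C where C: "C > 0" "\<And>n. n \<ge> 1 \<Longrightarrow> \<psi> n \<le> C * real n powr (- \<epsilon>)"
  proof -
    obtain c where c: "c > 0" "eventually (\<lambda>n. norm (\<psi> n) \<le> c * norm (real n powr (- \<epsilon>))) sequentially"
      using landau_o.bigE[OF assms(6)] by blast
    then obtain N where N: "\<And>n. n \<ge> N \<Longrightarrow> norm (\<psi> n) \<le> c * norm (real n powr (- \<epsilon>))"
      unfolding eventually_sequentially by blast
    \<comment> \<open>\<open>c\<close> serves n \<ge> N. For n < N the bounds \<psi>(n) \<le> 1/2
      and n^\<epsilon> \<le> N^\<epsilon> suffice.\<close>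
    define C where "C = c + real N powr \<epsilon>"
    have "\<psi> n \<le> C * real n powr (- \<epsilon>)" if "n \<ge> 1" for n
    proof (cases "n \<ge> N")
      case True
      then have "\<psi> n \<le> c * real n powr (- \<epsilon>)"
        using N[OF True] by simp
      also have "\<dots> \<le> C * real n powr (- \<epsilon>)"
        unfolding C_def by (intro mult_right_mono) auto
      finally show ?thesis .
    next
      case False
      have "\<psi> n \<le> real n powr \<epsilon> * real n powr (- \<epsilon>)"
        using \<psi>[OF that] that by (simp flip: powr_add)
      also have "\<dots> \<le> real N powr \<epsilon> * real n powr (- \<epsilon>)"
        using False \<open>\<epsilon> > 0\<close> by (intro mult_right_mono powr_mono2) auto
      also have "\<dots> \<le> C * real n powr (- \<epsilon>)"
        unfolding C_def using c(1) by (intro mult_right_mono) auto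
      finally show ?thesis .
    qed
    moreover have "C > 0"
      unfolding C_def using c(1) by (simp add: add_pos_nonneg)
    ultimately show ?thesis
      using that by blast
  qed
  obtain c \<kappa> where "c > 0" "\<kappa> > 0" and large: "overlaps_need_large_multiplier \<gamma> \<psi> c \<kappa>"
    using overlap_multiplier_large[OF assms(1,2,3) C] by metis
  obtain K where K: "K > 0"
    "\<And>n. n \<ge> 1 \<Longrightarrow> (\<Sum>q\<in>shell n. real (card (large_common_divisors c \<kappa> q))) \<le> K * real n"
    using sum_card_large_common_divisors_le[OF \<open>c > 0\<close> \<open>\<kappa> > 0\<close>] by metis
  \<comment> \<open>\<Phi> is the exact mean of the count. The second sum of
    \<open>main_term\<close> is left out here and enters only as part of the error.\<close>
  define \<Phi> where "\<Phi> n = 16 * (\<Sum>q=1..n. real q * \<psi> q)" for n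
  have \<Phi>_diff: "\<Phi> n - \<Phi> m = 16 * (\<Sum>k\<in>{m<..n}. real k * \<psi> k)" if "m \<le> n" for m n
  proof -
    have "{1..n} = {1..m} \<union> {m<..n}" "{1..m} \<inter> {m<..n} = {}"
      using that by auto
    then show ?thesis
      unfolding \<Phi>_def by (simp add: sum.union_disjoint)
  qed
  have \<Phi>_mono: "mono \<Phi>"
  proof (rule monoI)
    fix m n :: nat assume "m \<le> n"
    moreover have "(\<Sum>k\<in>{m<..n}. real k * \<psi> k) \<ge> 0"
      using \<psi> by (intro sum_nonneg mult_nonneg_nonneg) (auto simp: Suc_le_eq)
    ultimately show "\<Phi> m \<le> \<Phi> n"
      using \<Phi>_diff[of m n] by simp
  qed
  have \<Phi>_lim: "filterlim \<Phi> at_top sequentially"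
    unfolding \<Phi>_def by (intro filterlim_tendsto_pos_mult_at_top[OF tendsto_const _ assms(5)]) simp
  have "AE z in torus_measure. \<exists>C\<ge>0. \<forall>r Q. \<Phi> Q < 2 ^ r \<longrightarrow>
    \<bar>real (approx_count \<psi> z Q \<gamma>) - \<Phi> Q\<bar> \<le> C * (2 powr (real r / 2) * real (Suc r) powr (3/2 + \<delta>)) + 1"
  \<comment> \<open>\<Phi> carries the factor 16, so relative to it the variance constant 32 + 12K
    becomes at most 2 + K.\<close>
  proof (rule quantitative_Borel_Cantelli[where K = "2 + K"])
    show "(\<lambda>z. real (approx_count \<psi> z n \<gamma>)) \<in> borel_measurable torus_measure" for n
      unfolding approx_count_eq by measurable
    show "mono (\<lambda>n. real (approx_count \<psi> z n \<gamma>))" for z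
      unfolding approx_count_eq
      by (intro monoI sum_mono2 finite_annulus hits_nonneg) (auto simp: annulus_iff)
    show "real (approx_count \<psi> z 0 \<gamma>) = 0" for z
      unfolding approx_count_eq annulus_def by simp
    show "\<Phi> 0 = 0"
      unfolding \<Phi>_def by simp
    show "(\<integral>\<^sup>+z. ennreal ((real (approx_count \<psi> z n \<gamma>) - real (approx_count \<psi> z m \<gamma>) - (\<Phi> n - \<Phi> m))\<^sup>2) \<partial>torus_measure)
      \<le> ennreal ((2 + K) * (\<Phi> n - \<Phi> m))" if "m \<le> n" for m n
    proof -
      have "(\<Sum>k\<in>{m<..n}. real k * \<psi> k) \<ge> 0"
        using \<psi> by (intro sum_nonneg mult_nonneg_nonneg) (auto simp: Suc_le_eq)
      then have "(32 + 12 * K) * (\<Sum>k\<in>{m<..n}. real k * \<psi> k) \<le> (32 + 16 * K) * (\<Sum>k\<in>{m<..n}. real k * \<psi> k)"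
        using K(1) by (intro mult_right_mono) auto
      also have "\<dots> = (2 + K) * (\<Phi> n - \<Phi> m)"
        unfolding \<Phi>_diff[OF that] by (simp add: algebra_simps)
      finally have "(\<Sum>q\<in>annulus m n. \<Sum>q'\<in>annulus m n. hits_covariance \<gamma> \<psi> q q') \<le> (2 + K) * (\<Phi> n - \<Phi> m)"
        using sum_double_hits_covariance_le[of \<psi> \<gamma> c \<kappa> K m n] \<psi> large K(2) by simp
      then show ?thesis
        using variance_approx_count[of \<psi> \<gamma> m n] \<psi> that unfolding \<Phi>_diff[OF that] by blast
    qed
  qed (use \<Phi>_mono \<Phi>_lim K(1) \<open>\<delta> > 0\<close> in auto)
  then have "AE z in torus_measure. (\<lambda>Q. real (approx_count \<psi> z Q \<gamma>) - main_term \<psi> Q) \<in>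
      O(\<lambda>Q. main_term \<psi> Q powr (1/2) * ln (main_term \<psi> Q) powr (3/2 + \<delta>))"
  proof eventually_elim
    case (elim z)
    then obtain D where D: "D \<ge> 0" "\<And>r Q. \<Phi> Q < 2 ^ r \<Longrightarrow>
      \<bar>real (approx_count \<psi> z Q \<gamma>) - \<Phi> Q\<bar> \<le> D * (2 powr (real r / 2) * real (Suc r) powr (3/2 + \<delta>)) + 1"
      by blast
    define e where "e = 3/2 + \<delta>"
    have "e \<ge> 0"
      unfolding e_def using \<open>\<delta> > 0\<close> by simp
    have ev: "eventually (\<lambda>Q. \<Phi> Q \<ge> 4) sequentially"
      using \<Phi>_lim by (simp add: filterlim_at_top)
    show ?case
      unfolding e_def[symmetric]
    \<comment> \<open>17 = 1 + 16: the additive 1 from interpolation is at most \<open>R\<close>,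
      and 8 times the second sum is at most 16 sqrt Y, hence at most 16 \<open>R\<close>.\<close>
    proof (rule landau_o.bigI[of "D * (2 * 4 powr e) + 17"], goal_cases)
      case 1
      then show ?case
        using D(1) by (simp add: add_nonneg_pos)
    next
      case 2
      from ev show ?case
      proof eventually_elim
        case (elim Q)
        define Y where "Y = main_term \<psi> Q"
        define R where "R = Y powr (1/2) * ln Y powr e"
        have Y: "Y = \<Phi> Q + 8 * (\<Sum>q=1..Q. \<psi> q)"
          unfolding Y_def main_term_def \<Phi>_def by simp
        have \<psi>0: "(\<Sum>q=1..Q. \<psi> q) \<ge> 0"
          using \<psi> by (intro sum_nonneg) auto
        then have "\<Phi> Q \<le> Y"
          unfolding Y by simp
        have "ln Y \<ge> 1"
        proof -
          have "exp 1 \<le> Y"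
            using elim \<open>\<Phi> Q \<le> Y\<close> exp_le by linarith
          then show ?thesis
            using elim \<open>\<Phi> Q \<le> Y\<close> by (simp add: ln_ge_iff)
        qed
        then have ln1: "ln Y powr e \<ge> 1"
          using \<open>e \<ge> 0\<close> by (rule ge_one_powr_ge_zero)
        have sqrtY: "sqrt Y \<ge> 1" "sqrt Y \<le> R"
        proof -
          show "sqrt Y \<ge> 1"
            using elim \<open>\<Phi> Q \<le> Y\<close> by simp
          then show "sqrt Y \<le> R"
            unfolding R_def using mult_left_mono[OF ln1, of "sqrt Y"] elim \<open>\<Phi> Q \<le> Y\<close>
            by (simp add: powr_half_sqrt)
        qed
        obtain r where r: "\<Phi> Q < 2 ^ r" "2 powr (real r / 2) * real (Suc r) powr e \<le> 2 * 4 powr e * R"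
          unfolding R_def using dyadic_error_le[OF elim \<open>\<Phi> Q \<le> Y\<close> \<open>e \<ge> 0\<close>] by metis
        have "\<bar>real (approx_count \<psi> z Q \<gamma>) - \<Phi> Q\<bar> \<le> D * (2 powr (real r / 2) * real (Suc r) powr e) + 1"
          using D(2)[OF r(1)] unfolding e_def .
        also have "\<dots> \<le> D * (2 * 4 powr e * R) + 1"
          using mult_left_mono[OF r(2) D(1)] by simp
        also have "D * (2 * 4 powr e * R) = D * (2 * 4 powr e) * R"
          by simp
        finally have 1: "\<bar>real (approx_count \<psi> z Q \<gamma>) - \<Phi> Q\<bar> \<le> D * (2 * 4 powr e) * R + R"
          using sqrtY by linarith
        have "(\<Sum>q=1..Q. \<psi> q) \<le> 2 * sqrt (\<Phi> Q)"
        proof (rule sum_le_sqrt_weighted_sum[OF \<psi>])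
          have "\<Phi> Q \<ge> 0"
            using elim by simp
          then show "(\<Sum>q=1..Q. real q * \<psi> q) \<le> \<Phi> Q"
            unfolding \<Phi>_def by simp
        qed (use elim in auto)
        also have "sqrt (\<Phi> Q) \<le> sqrt Y"
          using \<open>\<Phi> Q \<le> Y\<close> by simp
        finally have 2: "\<bar>\<Phi> Q - Y\<bar> \<le> 16 * R"
          using \<psi>0 sqrtY(2) Y by linarith
        have "\<bar>real (approx_count \<psi> z Q \<gamma>) - Y\<bar> \<le> (D * (2 * 4 powr e) + 17) * R"
          using 1 2 by (simp add: algebra_simps)
        moreover have "R \<ge> 0"
          unfolding R_def by simp
        ultimately show ?case
          unfolding Y_def R_def by simp
      qed
    qed
  qed
  then show ?thesis
    by (rule AE_lebesgue_on_unit_square)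
qed

end
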